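(* Let $X$ be a Polish space and let $\mathcal{G}$ be a countable family of nearly open (analytic) hypergraphs on $X$. Then the quotient poset $P_{I_{\mathcal{G}}}$ is proper.
   Context: For a Polish space $X$, $X^{\leq\omega}$ denotes the space of all finite sequences and all $\omega$-sequences of elements of $X$. A hypergraph on $X$ is a set $G\subset X^{\leq\omega}$; its elements are called edges. $G$ is analytic if it is an analytic subset of $X^{\leq\omega}$. A $G$-anticlique is a set $B\subset X$ with $B^{\leq\omega}\cap G=\emptyset$. For a countable collection $\mathcal{G}$ of hypergraphs on $X$, $I_{\mathcal{G}}$ is the $\sigma$-ideal on $X$ $\sigma$-generated by the Borel sets which are anticliques in at least one of the hypergraphs in $\mathcal{G}$. For a $\sigma$-ideal $I$, $P_I$ is the poset of Borel subsets of $X$ not in $I$, ordered by inclusion. An analytic hypergraph $G$ on $X$ is nearly open if for each edge $e\in G$ and every $i\in\mathrm{dom}(e)\setminus\{0\}$ there are open sets $O_i\subset X$ containing $e(i)$ such that for every choice of points $x_i\in O_i$ ($i\in\mathrm{dom}(e)\setminus\{0\}$), the sequence obtained from $e$ by keeping $e(0)$ and replacing $e(i)$ with $x_i$ for all $i\in\mathrm{dom}(e)\setminus\{0\}$ is an edge in $G$. *)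

theory Defs
  imports "HOL-Analysis.Analysis"
begin

unbundle cardinal_syntax

section \<open>Hypergraphs on a Polish space\<close>

text \<open>
  A finite or infinite sequence is a pair of its length \<open>n \<le> \<omega>\<close> and an extensional function
  on its domain \<open>{i. i < n}\<close> (the value outside the domain is \<open>undefined\<close>).
  The space of all of them is the disjoint sum of the finite powers and the countably infinite
  power of the space; the empty sequence is included.
\<close>

type_synonym 'a sequence = "enat \<times> (nat \<Rightarrow> 'a)"

definition seq_dom :: "enat \<Rightarrow> nat set" where
  "seq_dom n = {i. enat i < n}"

definition sequences :: "'a set \<Rightarrow> 'a sequence set" where
  "sequences B = (SIGMA n:UNIV. seq_dom n \<rightarrow>\<^sub>E B)"

definition sequence_topology :: "'a::topological_space sequence topology" where
  "sequence_topology = sum_topology (\<lambda>n. product_topology (\<lambda>i. euclidean) (seq_dom n)) UNIV"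

lemma topspace_sequence_topology: "topspace sequence_topology = sequences UNIV"
  by (auto simp: sequence_topology_def sequences_def)

text \<open>Analytic sets are the continuous images of Baire space, together with the empty set.\<close>

definition analytic_in :: "'b topology \<Rightarrow> 'b set \<Rightarrow> bool" where
  "analytic_in T A \<longleftrightarrow>
     A = {} \<or> (\<exists>f :: (nat \<Rightarrow> nat) \<Rightarrow> 'b. continuous_map euclidean T f \<and> range f = A)"

definition analytic_hypergraph :: "'a::polish_space sequence set \<Rightarrow> bool" where
  "analytic_hypergraph G \<longleftrightarrow> G \<subseteq> sequences UNIV \<and> analytic_in sequence_topology G"

definition anticlique :: "'a sequence set \<Rightarrow> 'a set \<Rightarrow> bool" where
  "anticlique G B \<longleftrightarrow> sequences B \<inter> G = {}"

definition nearly_open :: "'a::polish_space sequence set \<Rightarrow> bool" where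
  "nearly_open G \<longleftrightarrow> analytic_hypergraph G \<and>
     (\<forall>(n, e) \<in> G. \<exists>U :: nat \<Rightarrow> 'a set.
        (\<forall>i \<in> seq_dom n - {0}. open (U i) \<and> e i \<in> U i) \<and>
        (\<forall>x. (\<forall>i \<in> seq_dom n - {0}. x i \<in> U i) \<longrightarrow>
             (n, \<lambda>i. if i \<in> seq_dom n - {0} then x i else e i) \<in> G))"

definition hypergraph_ideal :: "'a::polish_space sequence set set \<Rightarrow> 'a set set" where
  "hypergraph_ideal \<G> =
     {A. \<exists>\<B>. countable \<B> \<and> (\<forall>B \<in> \<B>. B \<in> sets borel \<and> (\<exists>G \<in> \<G>. anticlique G B)) \<and> A \<subseteq> \<Union>\<B>}"

definition quotient_poset :: "'a::topological_space set set \<Rightarrow> 'a set set" where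
  "quotient_poset I = {B. B \<in> sets borel \<and> B \<notin> I}"

section \<open>Elementary submodels\<close>

text \<open>First-order formulas of the language of set theory, with variables named by numbers.\<close>

datatype fm = Mem nat nat | Eq nat nat | Neg fm | Conj fm fm | All nat fm

primrec sat :: "'u set \<Rightarrow> 'u rel \<Rightarrow> fm \<Rightarrow> (nat \<Rightarrow> 'u) \<Rightarrow> bool" where
  "sat H E (Mem i j) s \<longleftrightarrow> (s i, s j) \<in> E"
| "sat H E (Eq i j) s \<longleftrightarrow> s i = s j"
| "sat H E (Neg \<phi>) s \<longleftrightarrow> \<not> sat H E \<phi> s"
| "sat H E (Conj \<phi> \<psi>) s \<longleftrightarrow> sat H E \<phi> s \<and> sat H E \<psi> s"
| "sat H E (All i \<phi>) s \<longleftrightarrow> (\<forall>a \<in> H. sat H E \<phi> (s(i := a)))"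

definition elementary_submodel :: "'u set \<Rightarrow> 'u set \<Rightarrow> 'u rel \<Rightarrow> bool" where
  "elementary_submodel M H E \<longleftrightarrow> M \<subseteq> H \<and>
     (\<forall>\<phi> s. range s \<subseteq> M \<longrightarrow> (sat M E \<phi> s \<longleftrightarrow> sat H E \<phi> s))"

section \<open>The structure of sets hereditarily of size less than a regular cardinal\<close>

definition elts :: "'u rel \<Rightarrow> 'u \<Rightarrow> 'u set" where
  "elts E x = {z. (z, x) \<in> E}"

text \<open>
  \<open>(H, E)\<close> is an isomorphic copy of \<open>(H\<^sub>\<theta>, \<in>)\<close> for a regular uncountable cardinal \<open>\<theta>\<close>: it is
  well-founded and extensional, and a set of members of \<open>H\<close> is the set of elements of some member
  of \<open>H\<close> if and only if its cardinality is less than \<open>\<theta>\<close>. By Mostowski's theorem these conditions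
  determine \<open>(H, E)\<close> up to isomorphism, and \<open>H\<^sub>\<theta>\<close> satisfies them. Since \<open>H\<^sub>\<theta>\<close> has at
  least \<open>\<theta>\<close> members, it is no restriction that \<open>\<theta>\<close> is a well-order on elements of the same type.
\<close>

definition hereditary_structure :: "'u rel \<Rightarrow> 'u set \<Rightarrow> 'u rel \<Rightarrow> bool" where
  "hereditary_structure \<theta> H E \<longleftrightarrow>
     Card_order \<theta> \<and> regularCard \<theta> \<and> natLeq <o \<theta> \<and>
     E \<subseteq> H \<times> H \<and> wf E \<and> inj_on (elts E) H \<and>
     (\<forall>A. A \<subseteq> H \<and> |A| <o \<theta> \<longleftrightarrow> (\<exists>x \<in> H. elts E x = A))"

text \<open>\<open>z\<close> is the Kuratowski pair \<open>{{x}, {x, y}}\<close> of \<open>x\<close> and \<open>y\<close>.\<close>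

definition is_kpair :: "'u rel \<Rightarrow> 'u \<Rightarrow> 'u \<Rightarrow> 'u \<Rightarrow> bool" where
  "is_kpair E x y z \<longleftrightarrow>
     (\<exists>a b. elts E a = {x} \<and> elts E b = {x, y} \<and> elts E z = {a, b})"

section \<open>Proper posets\<close>

definition compatible :: "'p set \<Rightarrow> ('p \<Rightarrow> 'p \<Rightarrow> bool) \<Rightarrow> 'p \<Rightarrow> 'p \<Rightarrow> bool" where
  "compatible P le p q \<longleftrightarrow> (\<exists>r \<in> P. le r p \<and> le r q)"

definition dense_in_poset :: "'p set \<Rightarrow> ('p \<Rightarrow> 'p \<Rightarrow> bool) \<Rightarrow> 'p set \<Rightarrow> bool" where
  "dense_in_poset P le D \<longleftrightarrow> D \<subseteq> P \<and> (\<forall>p \<in> P. \<exists>d \<in> D. le d p)"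

definition predense_below :: "'p set \<Rightarrow> ('p \<Rightarrow> 'p \<Rightarrow> bool) \<Rightarrow> 'p \<Rightarrow> 'p set \<Rightarrow> bool" where
  "predense_below P le q D \<longleftrightarrow> (\<forall>r \<in> P. le r q \<longrightarrow> (\<exists>d \<in> D. compatible P le d r))"

text \<open>
  The members \<open>u\<close> and \<open>l\<close> of \<open>H\<close> are the underlying set and the ordering, as a set of ordered
  pairs, of the isomorphic copy of the poset under the injection \<open>c\<close>.
\<close>

definition codes_poset ::
  "'u set \<Rightarrow> 'u rel \<Rightarrow> 'p set \<Rightarrow> ('p \<Rightarrow> 'p \<Rightarrow> bool) \<Rightarrow> ('p \<Rightarrow> 'u) \<Rightarrow> 'u \<Rightarrow> 'u \<Rightarrow> bool" where
  "codes_poset H E P le c u l \<longleftrightarrow>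
     inj_on c P \<and> u \<in> H \<and> l \<in> H \<and> elts E u = c ` P \<and>
     elts E l = {z \<in> H. \<exists>p \<in> P. \<exists>q \<in> P. le p q \<and> is_kpair E (c p) (c q) z}"

text \<open>\<open>q\<close> is \<open>(M, P)\<close>-generic: for each dense \<open>D \<in> M\<close>, the set \<open>D \<inter> M\<close> is predense below \<open>q\<close>.\<close>

definition generic_condition ::
  "'u set \<Rightarrow> 'u rel \<Rightarrow> 'p set \<Rightarrow> ('p \<Rightarrow> 'p \<Rightarrow> bool) \<Rightarrow> ('p \<Rightarrow> 'u) \<Rightarrow> 'p \<Rightarrow> bool" where
  "generic_condition M E P le c q \<longleftrightarrow>
     (\<forall>D. dense_in_poset P le D \<and> (\<exists>d \<in> M. elts E d = c ` D) \<longrightarrow>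
          predense_below P le q {p \<in> D. c p \<in> M})"

text \<open>
  Properness: for every regular \<open>\<theta> > 2\<^bsup>|P|\<^esup>\<close> and every countable elementary submodel \<open>M\<close> of
  \<open>H\<^sub>\<theta>\<close> containing the poset, each condition in \<open>M\<close> is above an \<open>(M, P)\<close>-generic condition.
  The copies of \<open>H\<^sub>\<theta>\<close> range over the subsets of the type \<open>'u\<close>. A theorem in which \<open>'u\<close> is a type
  variable therefore speaks about every such \<open>\<theta>\<close> for which some type accommodates \<open>H\<^sub>\<theta>\<close>.
\<close>

definition proper_poset :: "'u itself \<Rightarrow> 'p set \<Rightarrow> ('p \<Rightarrow> 'p \<Rightarrow> bool) \<Rightarrow> bool" where
  "proper_poset (_ :: 'u itself) P le \<longleftrightarrow>
     (\<forall>(\<theta> :: 'u rel) H E c u l M.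
        hereditary_structure \<theta> H E \<and> |Pow P| <o \<theta> \<and>
        codes_poset H E P le c u l \<and>
        countable M \<and> elementary_submodel M H E \<and> u \<in> M \<and> l \<in> M \<longrightarrow>
        (\<forall>p \<in> P. c p \<in> M \<longrightarrow> (\<exists>q \<in> P. le q p \<and> generic_condition M E P le c q)))"

end

(*
  For a nearly open hypergraph G let Phi(S) be the set of first points of edges whose remaining
  points lie in the closure of S. Near openness makes B a G-anticlique if and only if B and Phi(B)
  are disjoint, and Phi(S) is analytic and depends on the closure of S only.

  Let M be a countable submodel and let C be the set of points of a condition p that are generic
  over M. If C were covered by anticliques B_n, one could descend through conditions of M meeting
  all dense sets and avoiding B_n at stage n: either some stronger condition has no generic points
  in B_n, or the generic points in B_n are dense in the current condition q (pruned to its positive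
  part), and then q Int Phi_n(q) is positive and disjoint from B_n. The intersection of the descending
  sequence contains a generic point outside every B_n. So C is positive, and it is (M, P)-generic.

  The step to q Int Phi_n(q) needs a Borel condition inside a positive analytic set. It is found by
  the same fusion, carried out with analytic sets as conditions, and Lusin separation.
*)
theory Submission
  imports Defs "HOL-Library.Countable_Set_Type"
begin

section \<open>Suslin sets\<close>

text \<open>Properness concerns every countable submodel containing the poset, while the fusion
  refers to the maps Phi_n, to trees of witnesses and to a numbered base, which such a submodel may
  fail to contain. Hence the fusion is stated for countable families of conditions closed under a
  countable list of requirements, and a submodel is linked to such a family through a relation
  coding the requirements. Conditions are not closed, so the limit of a descending sequence with
  vanishing diameters may escape from them. Each condition is therefore given as the projection of a
  closed set, and the sequence also decides witnesses coordinate by coordinate; this puts the limit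
  into every condition. If q Int Phi_n(q) were small, the rest of q would essentially be a Suslin
  anticlique, which Lusin separation encloses in a Borel one. Disjointness from B_n holds because
  density gives Phi_n(q) \<subseteq> Phi_n(B_n). Obtaining Borel conditions is not circular: the
  fusion lemma asks only for Suslin conditions, and its first application, to positive Suslin sets,
  makes the requirements attainable by Borel sets.\<close>

definition suslin :: "'a::topological_space set \<Rightarrow> bool" where
  "suslin A \<longleftrightarrow> (\<exists>F :: ('a \<times> (nat \<Rightarrow> nat)) set. closed F \<and> A = fst ` F)"

text \<open>The Suslin scheme of the projection of \<open>F\<close>, indexed by initial segments of
  witnesses.\<close>

definition branch :: "('a \<times> (nat \<Rightarrow> nat)) set \<Rightarrow> nat list \<Rightarrow> 'a set" where
  "branch F s = fst ` {z \<in> F. map (snd z) [0..<length s] = s}"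

lemma branch_Nil: "branch F [] = fst ` F"
  by (simp add: branch_def)

lemma branch_split: "branch F s = (\<Union>j. branch F (s @ [j]))"
  by (auto simp: branch_def image_iff)

lemma continuous_on_reindex: "continuous_on UNIV (\<lambda>y :: nat \<Rightarrow> nat. \<lambda>i. y (g i))"
  by (intro continuous_on_coordinatewise_then_product continuous_on_product_coordinates)

lemma open_coordinate: "open {y :: nat \<Rightarrow> nat. P (y i)}"
proof -
  have "open ((\<lambda>y :: nat \<Rightarrow> nat. y i) -` Collect P)"
    by (intro open_vimage continuous_on_product_coordinates) (simp add: open_discrete)
  then show ?thesis by (simp add: vimage_def)
qed

lemma closed_cylinder: "closed {z :: 'a::topological_space \<times> (nat \<Rightarrow> nat). map (snd z) [0..<length s] = s}"
proof -
  have "closed {y :: nat \<Rightarrow> nat. y i = s ! i}" for i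
    using open_coordinate[of "\<lambda>n. n \<noteq> s ! i" i] by (simp add: closed_def Collect_neg_eq[symmetric])
  then have "closed (snd -` (\<Inter>i\<in>{..<length s}. {y. y i = s ! i}) :: ('a \<times> (nat \<Rightarrow> nat)) set)"
    by (intro closed_vimage closed_INT continuous_on_snd continuous_on_id) auto
  moreover have "(snd -` (\<Inter>i\<in>{..<length s}. {y. y i = s ! i}) :: ('a \<times> (nat \<Rightarrow> nat)) set)
      = {z. map (snd z) [0..<length s] = s}"
    unfolding list_eq_iff_nth_eq by auto
  ultimately show ?thesis by simp
qed

lemma suslin_branch: "closed F \<Longrightarrow> suslin (branch F s)"
  unfolding suslin_def branch_def
  by (rule exI[of _ "F \<inter> {z. map (snd z) [0..<length s] = s}"])
     (auto intro!: closed_Int closed_cylinder)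

lemma open_contains_cylinder:
  fixes B :: "(nat \<Rightarrow> nat) set"
  assumes "open B" "y \<in> B"
  shows "\<exists>m. \<forall>z. (\<forall>i<m. z i = y i) \<longrightarrow> z \<in> B"
proof -
  have "openin (product_topology (\<lambda>i. euclidean) UNIV) B"
    using assms(1) by (simp add: open_fun_def)
  from product_topology_open_contains_basis[OF this assms(2)] obtain X where
    X: "y \<in> (\<Pi>\<^sub>E i\<in>UNIV. X i)" "finite {i. X i \<noteq> topspace (euclidean :: nat topology)}"
       "(\<Pi>\<^sub>E i\<in>UNIV. X i) \<subseteq> B" by blast
  obtain m where m: "\<And>i. X i \<noteq> UNIV \<Longrightarrow> i < m"
    using X(2) unfolding finite_nat_set_iff_bounded by auto
  show ?thesis
  proof (intro exI[of _ m] allI impI)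
    fix z :: "nat \<Rightarrow> nat" assume "\<forall>i<m. z i = y i"
    then have "z i \<in> X i" for i using X(1) m[of i] by (cases "i < m") auto
    then show "z \<in> B" using X(3) by auto
  qed
qed

text \<open>An open box around \<open>(x, y)\<close> missing \<open>F\<close> has a second factor
  containing a cylinder of some length \<open>m\<close> about \<open>y\<close>; its first factor
  would then miss the branch of length \<open>m\<close>. Coherent decisions about a witness thus
  turn a limit point into a member.\<close>

lemma branch_limit:
  assumes "closed F" and "\<And>m. x \<in> closure (branch F (map y [0..<m]))"
  shows "(x, y) \<in> F"
proof (rule ccontr)
  assume "(x, y) \<notin> F"
  then have "(x, y) \<in> - F" by simp
  with open_Compl[OF assms(1)] obtain A B where
    AB: "open A" "open B" "(x, y) \<in> A \<times> B" "A \<times> B \<subseteq> - F"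
    by (rule open_prod_elim)
  have "x \<in> A" "y \<in> B" using AB(3) by simp_all
  obtain m where m: "\<And>z. (\<forall>i<m. z i = y i) \<Longrightarrow> z \<in> B"
    using open_contains_cylinder[OF AB(2) \<open>y \<in> B\<close>] by blast
  obtain x' where "x' \<in> A" "x' \<in> branch F (map y [0..<m])"
    using assms(2)[of m] \<open>x \<in> A\<close> open_Int_closure_eq_empty[OF AB(1), of "branch F (map y [0..<m])"] by blast
  then obtain z where "(x', z) \<in> F" "map z [0..<m] = map y [0..<m]"
    by (auto simp: branch_def)
  moreover from this(2) have "z \<in> B" by (intro m) auto
  ultimately show False using AB(4) \<open>x' \<in> A\<close> by auto
qed

section \<open>Closure properties of Suslin sets\<close>

lemma suslin_closed: "closed A \<Longrightarrow> suslin A"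
  unfolding suslin_def
  by (rule exI[of _ "A \<times> UNIV"]) (auto intro: closed_Times)

lemma suslin_UN:
  assumes "\<And>n::nat. suslin (A n)"
  shows "suslin (\<Union>n. A n)"
proof -
  obtain F where F: "\<And>n. closed (F n :: ('a \<times> (nat \<Rightarrow> nat)) set)" "\<And>n. A n = fst ` F n"
    using assms unfolding suslin_def by metis
  \<comment> \<open>Coordinate 0 of a witness names the index of a set, and the shifted tail
    witnesses membership in that set.\<close>
  let ?K = "{(x, y). (x, \<lambda>i. y (Suc i)) \<in> F (y 0)}"
  have cont: "continuous_on UNIV (\<lambda>z :: 'a \<times> (nat \<Rightarrow> nat). (fst z, \<lambda>i. snd z (Suc i)))"
    by (intro continuous_on_Pair continuous_on_fst continuous_on_id
          continuous_on_compose2[OF continuous_on_reindex continuous_on_snd]) auto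
  have "- ?K = (\<Union>n. (snd -` {y. y 0 = n}) \<inter> ((\<lambda>z. (fst z, \<lambda>i. snd z (Suc i))) -` (- F n)))"
    by auto
  also have "open \<dots>"
    using F(1) by (intro open_UN ballI open_Int open_vimage[OF _ cont]
        open_vimage[OF open_coordinate] continuous_on_snd continuous_on_id open_Compl)
  finally have "closed ?K" by (simp add: closed_def)
  moreover have "(\<Union>n. A n) = fst ` ?K"
  proof (intro equalityI subsetI)
    fix x assume "x \<in> (\<Union>n. A n)"
    then obtain n y where "(x, y) \<in> F n" by (auto simp: F(2))
    then show "x \<in> fst ` ?K"
      by (intro image_eqI[of _ _ "(x, case_nat n y)"]) auto
  next
    fix x assume "x \<in> fst ` ?K"
    then obtain y where "(x, \<lambda>i. y (Suc i)) \<in> F (y 0)" by auto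
    then show "x \<in> (\<Union>n. A n)" using F(2) by force
  qed
  ultimately show ?thesis unfolding suslin_def by blast
qed

lemma suslin_INT:
  assumes "\<And>n::nat. suslin (A n)"
  shows "suslin (\<Inter>n. A n)"
proof -
  obtain F where F: "\<And>n. closed (F n :: ('a \<times> (nat \<Rightarrow> nat)) set)" "\<And>n. A n = fst ` F n"
    using assms unfolding suslin_def by metis
  \<comment> \<open>One witness interleaves witnesses for all the sets by means of the pairing of
    natural numbers.\<close>
  let ?h = "\<lambda>n (z :: 'a \<times> (nat \<Rightarrow> nat)). (fst z, \<lambda>i. snd z (prod_encode (n, i)))"
  have cont: "continuous_on UNIV (?h n)" for n
    by (intro continuous_on_Pair continuous_on_fst continuous_on_id
          continuous_on_compose2[OF continuous_on_reindex continuous_on_snd]) auto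
  have "closed (\<Inter>n. ?h n -` F n)"
    using F(1) by (intro closed_INT ballI closed_vimage[OF _ cont])
  moreover have "(\<Inter>n. A n) = fst ` (\<Inter>n. ?h n -` F n)"
  proof (intro equalityI subsetI)
    fix x assume "x \<in> (\<Inter>n. A n)"
    then have "\<forall>n. \<exists>y. (x, y) \<in> F n" by (force simp: F(2))
    then obtain y where "\<And>n. (x, y n) \<in> F n" by metis
    then show "x \<in> fst ` (\<Inter>n. ?h n -` F n)"
      by (intro image_eqI[of _ _ "(x, \<lambda>m. case prod_decode m of (n, i) \<Rightarrow> y n i)"]) auto
  next
    fix x assume "x \<in> fst ` (\<Inter>n. ?h n -` F n)"
    then obtain y where "\<And>n. (x, \<lambda>i. y (prod_encode (n, i))) \<in> F n" by auto
    then show "x \<in> (\<Inter>n. A n)" using F(2) by force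
  qed
  ultimately show ?thesis unfolding suslin_def by blast
qed

lemma suslin_Int:
  assumes "suslin A" "suslin B"
  shows "suslin (A \<inter> B)"
proof -
  have "A \<inter> B = (\<Inter>n::nat. if n = 0 then A else B)"
    by (auto split: if_splits)
  then show ?thesis using suslin_INT[of "\<lambda>n. if n = 0 then A else B"] assms by simp
qed

lemma suslin_UN_countable:
  assumes "countable I" "\<And>i. i \<in> I \<Longrightarrow> suslin (A i)"
  shows "suslin (\<Union>i\<in>I. A i)"
proof (cases "I = {}")
  case False
  then have "(\<Union>i\<in>I. A i) = (\<Union>n. A (from_nat_into I n))"
    by (metis UN_extend_simps(10) assms(1) range_from_nat_into)
  then show ?thesis using suslin_UN[of "\<lambda>n. A (from_nat_into I n)"] assms False
    by (simp add: from_nat_into)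
qed (simp add: suslin_closed)

lemma suslin_open:
  fixes U :: "'a::metric_space set"
  assumes "open U"
  shows "suslin U"
proof (cases "U = UNIV")
  case False
  have "x \<in> U \<longleftrightarrow> (\<exists>n::nat. inverse (Suc n) \<le> infdist x (- U))" for x
  proof
    assume "x \<in> U"
    then have "infdist x (- U) > 0"
      using assms False by (metis ComplD Compl_UNIV_eq closed_Compl double_complement
          in_closed_iff_infdist_zero infdist_nonneg less_eq_real_def)
    then show "\<exists>n::nat. inverse (Suc n) \<le> infdist x (- U)"
      using reals_Archimedean less_imp_le by blast
  next
    assume "\<exists>n::nat. inverse (Suc n) \<le> infdist x (- U)"
    then have "infdist x (- U) \<noteq> 0"
      by (metis inverse_positive_iff_positive not_le of_nat_0_less_iff zero_less_Suc)
    then show "x \<in> U" by (metis Compl_iff infdist_zero)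
  qed
  then have "U = (\<Union>n::nat. {x. inverse (Suc n) \<le> infdist x (- U)})" by blast
  moreover have "suslin (\<Union>n::nat. {x. inverse (Suc n) \<le> infdist x (- U)})"
    by (intro suslin_UN suslin_closed closed_Collect_le continuous_intros)
  ultimately show ?thesis by simp
qed (simp add: suslin_closed)

text \<open>The induction carries the complement along, since Suslin sets need not be closed under
  complementation.\<close>

lemma suslin_borel:
  fixes B :: "'a::metric_space set"
  assumes "B \<in> sets borel"
  shows "suslin B"
proof -
  have "B \<in> sigma_sets UNIV {S. open S}"
    using assms by (simp add: sets_borel)
  then have "suslin B \<and> suslin (- B)"
  proof induction
    case (Basic a)
    then show ?case by (auto intro: suslin_open suslin_closed)
  next
    case Empty
    then show ?case by (simp add: suslin_closed)
  next
    case (Compl a)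
    then show ?case by (simp add: Compl_eq_Diff_UNIV[symmetric])
  next
    case (Union a)
    then show ?case by (auto intro: suslin_UN suslin_INT)
  qed
  then show ?thesis ..
qed

lemma small_closed_cover:
  fixes e :: real
  assumes "e > 0"
  shows "\<exists>K :: nat \<Rightarrow> 'a::{metric_space, second_countable_topology} set.
    (\<forall>n. closed (K n)) \<and> (\<forall>n. \<forall>x \<in> K n. \<forall>y \<in> K n. dist x y \<le> e) \<and> (\<Union>n. K n) = UNIV"
proof -
  obtain D :: "'a set" where D: "countable D" "\<And>X. open X \<Longrightarrow> X \<noteq> {} \<Longrightarrow> \<exists>d\<in>D. d \<in> X"
    using countable_dense_setE by blast
  have ne: "D \<noteq> {}" using D(2)[of UNIV] by auto
  have "dist x y \<le> e"
    if "x \<in> cball (from_nat_into D n) (e / 2)" "y \<in> cball (from_nat_into D n) (e / 2)" for n x y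
    using that dist_triangle2[of x y "from_nat_into D n"] by (simp add: dist_commute)
  moreover have "x \<in> (\<Union>n. cball (from_nat_into D n) (e / 2))" for x
  proof -
    obtain d where "d \<in> D" "d \<in> ball x (e / 2)"
      using D(2)[of "ball x (e / 2)"] assms by auto
    moreover obtain n where "d = from_nat_into D n"
      using \<open>d \<in> D\<close> D(1) by (metis from_nat_into_surj)
    ultimately show ?thesis
      by (auto simp: dist_commute intro!: exI[of _ n])
  qed
  ultimately show ?thesis
    by (intro exI[of _ "\<lambda>n. cball (from_nat_into D n) (e / 2)"]) blast
qed

lemma iterated_append_eq_map:
  assumes "s 0 = []" "\<And>n. s (Suc n) = s n @ [y n]"
  shows "s n = map y [0..<n]"
  by (induction n) (simp_all add: assms)

text \<open>Cantor's intersection theorem. The bound concerns \<open>S (Suc n)\<close> because the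
  constructions start from an arbitrary set and shrink from their first step on.\<close>

lemma nested_closures_meet:
  fixes S :: "nat \<Rightarrow> 'a::complete_space set"
  assumes "\<And>n. S n \<noteq> {}" "\<And>n. S (Suc n) \<subseteq> S n"
    and "\<And>n x y. x \<in> S (Suc n) \<Longrightarrow> y \<in> S (Suc n) \<Longrightarrow> dist x y \<le> (1 / 2) ^ n"
  obtains a where "\<And>n. a \<in> closure (S n)"
proof -
  have "\<exists>a. \<forall>n. a \<in> closure (S n)"
  proof (rule decreasing_closed_nest)
    show "closure (S n) \<subseteq> closure (S m)" if "m \<le> n" for m n
      using that assms(2) by (meson closure_mono lift_Suc_antimono_le)
    show "\<exists>n. \<forall>x\<in>closure (S n). \<forall>y\<in>closure (S n). dist x y < e" if "e > 0" for e :: real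
    proof -
      obtain n where n: "(1 / 2) ^ n < e / 3"
        using real_arch_pow_inv[of "e / 3" "1 / 2"] \<open>e > 0\<close> by auto
      have "dist x y < e" if xy: "x \<in> closure (S (Suc n))" "y \<in> closure (S (Suc n))" for x y
      proof -
        obtain x' y' where "x' \<in> S (Suc n)" "dist x' x < e / 3" "y' \<in> S (Suc n)" "dist y' y < e / 3"
          using xy \<open>e > 0\<close> unfolding closure_approachable
          by (metis divide_pos_pos zero_less_numeral)
        moreover from this have "dist x' y' < e / 3" using assms(3) n by fastforce
        ultimately show ?thesis
          using dist_triangle[of x y x'] dist_triangle[of x' y y'] by (simp add: dist_commute)
      qed
      then show ?thesis by blast
    qed
  qed (use assms in auto)
  then show thesis using that by blast
qed

section \<open>Lusin separation\<close>

definition borel_separated :: "'a::topological_space set \<Rightarrow> 'a set \<Rightarrow> bool" where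
  "borel_separated A B \<longleftrightarrow> (\<exists>S \<in> sets borel. A \<subseteq> S \<and> S \<inter> B = {})"

text \<open>Used contrapositively: inseparability of two countable unions is inherited by some pair
  of pieces, which drives the descent in Lusin's theorem.\<close>

lemma borel_separated_UN:
  fixes A B :: "nat \<Rightarrow> 'a::topological_space set"
  assumes "\<And>i j. borel_separated (A i) (B j)"
  shows "borel_separated (\<Union>i. A i) (\<Union>j. B j)"
proof -
  obtain S where S: "\<And>i j. S i j \<in> sets borel" "\<And>i j. A i \<subseteq> S i j" "\<And>i j. S i j \<inter> B j = {}"
    using assms unfolding borel_separated_def by metis
  have "(\<Inter>j. S i j) \<in> sets borel" for i
    using S(1) by (intro sets.countable_INT) auto
  then have "(\<Union>i. \<Inter>j. S i j) \<in> sets borel"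
    by (intro sets.countable_UN) auto
  moreover have "(\<Union>i. A i) \<subseteq> (\<Union>i. \<Inter>j. S i j)" using S(2) by auto
  moreover have "(\<Union>i. \<Inter>j. S i j) \<inter> (\<Union>j. B j) = {}" using S(3) by fast
  ultimately show ?thesis unfolding borel_separated_def by blast
qed

text \<open>Descend through both schemes, keeping the pieces inseparable and cutting the first one
  by closed sets \<open>K\<close> of vanishing diameter. The limit point has witnesses in both
  schemes, against disjointness.\<close>

theorem lusin_separation:
  fixes A B :: "'a::polish_space set"
  assumes "suslin A" "suslin B" "A \<inter> B = {}"
  shows "borel_separated A B"
proof (rule ccontr)
  assume nsep: "\<not> borel_separated A B"
  obtain F G :: "('a \<times> (nat \<Rightarrow> nat)) set" where F: "closed F" "A = fst ` F" and G: "closed G" "B = fst ` G"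
    using assms unfolding suslin_def by blast
  define P where "P = (\<lambda>(s, t, K :: 'a set). closed K \<and> \<not> borel_separated (branch F s \<inter> K) (branch G t))"
  define Q where "Q = (\<lambda>(n :: nat) (s :: nat list, t :: nat list, K :: 'a set) (s', t', K'). (\<exists>i. s' = s @ [i]) \<and> (\<exists>j. t' = t @ [j]) \<and> K' \<subseteq> K \<and>
      (\<forall>x \<in> K'. \<forall>y \<in> K'. dist x y \<le> (1 / 2) ^ n))"
  have "\<exists>\<sigma>. \<sigma> 0 = ([], [], UNIV) \<and> (\<forall>n. P (\<sigma> n)) \<and> (\<forall>n. Q n (\<sigma> n) (\<sigma> (Suc n)))"
  proof -
    have "\<exists>\<sigma>. \<forall>n. (P (\<sigma> n) \<and> (n = 0 \<longrightarrow> \<sigma> n = ([], [], UNIV))) \<and> Q n (\<sigma> n) (\<sigma> (Suc n))"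
    proof (rule dependent_nat_choice)
      show "\<exists>x. P x \<and> (0 = (0::nat) \<longrightarrow> x = ([], [], UNIV))"
        using nsep by (auto simp: P_def branch_Nil F G)
    next
      fix x and n :: nat
      assume "P x \<and> (n = 0 \<longrightarrow> x = ([], [], UNIV))"
      moreover obtain s t K where x: "x = (s, t, K)" by (cases x)
      ultimately have K: "closed K" "\<not> borel_separated (branch F s \<inter> K) (branch G t)"
        by (auto simp: P_def)
      obtain L :: "nat \<Rightarrow> 'a set" where L: "\<And>m. closed (L m)"
          "\<And>m x y. x \<in> L m \<Longrightarrow> y \<in> L m \<Longrightarrow> dist x y \<le> (1 / 2) ^ n" "(\<Union>m. L m) = UNIV"
        using small_closed_cover[of "(1 / 2) ^ n", where 'a = 'a] by (simp, blast)
      \<comment> \<open>The index codes the next coordinate of the witness together with the number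
        of a closed set of small diameter.\<close>
      define A' where "A' i = branch F (s @ [fst (prod_decode i)]) \<inter> (K \<inter> L (snd (prod_decode i)))" for i
      have "branch F s \<inter> K = (\<Union>i. A' i)"
      proof (intro equalityI subsetI)
        fix x assume x: "x \<in> branch F s \<inter> K"
        obtain m where "x \<in> L m" using L(3) by blast
        moreover obtain i where "x \<in> branch F (s @ [i])" using branch_split[of F s] x by blast
        ultimately have "x \<in> A' (prod_encode (i, m))" using x by (simp add: A'_def)
        then show "x \<in> (\<Union>i. A' i)" by blast
      next
        fix x assume "x \<in> (\<Union>i. A' i)"
        then show "x \<in> branch F s \<inter> K" using branch_split[of F s] by (auto simp: A'_def)
      qed
      then obtain i j where ij: "\<not> borel_separated (A' i) (branch G (t @ [j]))"
        using borel_separated_UN[of A' "\<lambda>j. branch G (t @ [j])"] K(2) branch_split[of G t] by auto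
      obtain i' m where "prod_decode i = (i', m)" by fastforce
      then have "P (s @ [i'], t @ [j], K \<inter> L m) \<and> Q n x (s @ [i'], t @ [j], K \<inter> L m)"
        using K(1) L(1,2) ij by (auto simp: P_def Q_def x A'_def)
      then show "\<exists>y. (P y \<and> (Suc n = 0 \<longrightarrow> y = ([], [], UNIV))) \<and> Q n x y" by blast
    qed
    then show ?thesis by blast
  qed
  then obtain \<sigma> where \<sigma>: "\<sigma> 0 = ([], [], UNIV)" "\<And>n. P (\<sigma> n)" "\<And>n. Q n (\<sigma> n) (\<sigma> (Suc n))"
    by blast
  define s t K where "s n = fst (\<sigma> n)" and "t n = fst (snd (\<sigma> n))" and "K n = snd (snd (\<sigma> n))" for n
  have \<sigma>_eq: "\<sigma> n = (s n, t n, K n)" for n by (simp add: s_def t_def K_def)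
  have "\<exists>y z. \<forall>n. s (Suc n) = s n @ [y n] \<and> t (Suc n) = t n @ [z n]"
    using \<sigma>(3) unfolding Q_def \<sigma>_eq by simp metis
  then obtain y z where s_Suc: "\<And>n. s (Suc n) = s n @ [y n]" and t_Suc: "\<And>n. t (Suc n) = t n @ [z n]"
    by blast
  have "s 0 = []" "t 0 = []" using \<sigma>(1) by (simp_all add: s_def t_def)
  then have st: "s n = map y [0..<n]" "t n = map z [0..<n]" for n
    using s_Suc t_Suc by (auto intro!: iterated_append_eq_map)
  have K: "closed (K n)" "\<not> borel_separated (branch F (s n) \<inter> K n) (branch G (t n))" for n
    using \<sigma>(2)[of n] by (auto simp: P_def \<sigma>_eq)
  have K_anti: "K (Suc n) \<subseteq> K n" and K_diam: "\<And>x y. x \<in> K (Suc n) \<Longrightarrow> y \<in> K (Suc n) \<Longrightarrow> dist x y \<le> (1 / 2) ^ n" for n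
    using \<sigma>(3)[of n] by (auto simp: Q_def \<sigma>_eq)
  have meetsF: "branch F (s n) \<inter> K n \<noteq> {}" for n
    using K(2)[of n] unfolding borel_separated_def by (metis empty_subsetI inf_bot_left sets.empty_sets)
  \<comment> \<open>The second piece is not cut by \<open>K n\<close>, but it cannot miss it:
    otherwise the Borel set \<open>K n\<close> would separate.\<close>
  have meetsG: "branch G (t n) \<inter> K n \<noteq> {}" for n
    using K(2)[of n] borel_closed[OF K(1)[of n]] unfolding borel_separated_def
    by (metis inf_commute inf_le2)
  obtain x where x: "\<And>n. x \<in> closure (branch F (s n) \<inter> K n)"
  proof (rule nested_closures_meet)
    show "branch F (s (Suc n)) \<inter> K (Suc n) \<subseteq> branch F (s n) \<inter> K n" for n
      using K_anti[of n] branch_split[of F "s n"] s_Suc[of n] by auto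
  qed (use meetsF K_diam in auto)
  have "x \<in> closure (branch F (map y [0..<m]))" for m
    using x[of m] closure_mono[of "branch F (s m) \<inter> K m" "branch F (s m)"] by (auto simp: st)
  then have "(x, y) \<in> F" by (rule branch_limit[OF F(1)])
  moreover have "(x, z) \<in> G"
  proof (rule branch_limit[OF G(1)])
    fix m
    \<comment> \<open>At a late stage \<open>K\<close> contains both \<open>x\<close> and a point of
      the second piece, so its diameter bounds their distance.\<close>
    have "x \<in> closure (branch G (t m))"
      unfolding closure_approachable
    proof (intro allI impI)
      fix e :: real assume "e > 0"
      obtain n where n: "(1 / 2) ^ n < e" using real_arch_pow_inv[of e "1 / 2"] \<open>e > 0\<close> by auto
      let ?k = "Suc (max m n)"
      obtain g where g: "g \<in> branch G (t ?k)" "g \<in> K ?k" using meetsG[of ?k] by blast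
      have "x \<in> K ?k" using x[of ?k] K(1)[of ?k] by (meson closure_minimal inf_le2 subsetD)
      then have "dist g x \<le> (1 / 2) ^ max m n" using g K_diam by blast
      also have "\<dots> \<le> (1 / 2) ^ n" by (simp add: power_decreasing)
      finally have "dist g x < e" using n by simp
      moreover have "branch G (t (Suc k)) \<subseteq> branch G (t k)" for k
        using branch_split[of G "t k"] t_Suc[of k] by auto
      then have "branch G (t ?k) \<subseteq> branch G (t m)"
        by (rule lift_Suc_antimono_le) auto
      ultimately show "\<exists>g\<in>branch G (t m). dist g x < e" using g(1) by blast
    qed
    then show "x \<in> closure (branch G (map z [0..<m]))" by (simp add: st)
  qed
  ultimately show False using assms(3) F(2) G(2) by force
qed

section \<open>Fusion for ideals generated by anticliques\<close>

lemma infinite_branch: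
  assumes "P []" "\<And>s. P s \<Longrightarrow> \<exists>j::nat. P (s @ [j])"
  obtains y where "\<And>m. P (map y [0..<m])"
proof -
  have "\<exists>\<sigma>. \<forall>n. (P (\<sigma> n) \<and> (n = 0 \<longrightarrow> \<sigma> n = [])) \<and> (\<exists>j. \<sigma> (Suc n) = \<sigma> n @ [j])"
    by (rule dependent_nat_choice) (use assms in auto)
  then obtain \<sigma> where \<sigma>: "\<And>n. P (\<sigma> n)" "\<sigma> 0 = []" "\<And>n. \<exists>j. \<sigma> (Suc n) = \<sigma> n @ [j]"
    by blast
  then obtain y where "\<And>n. \<sigma> (Suc n) = \<sigma> n @ [y n]" by metis
  then have "\<sigma> n = map y [0..<n]" for n using iterated_append_eq_map \<sigma>(2) by blast
  then show thesis using that \<sigma>(1) by metis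
qed

text \<open>A Skolem hull: it produces the countable families that play the part of
  submodels.\<close>

lemma countable_closure_binary:
  fixes f :: "'i::countable \<Rightarrow> 'b \<Rightarrow> 'b \<Rightarrow> 'b"
  assumes "a \<in> R" "\<And>i x y. x \<in> R \<Longrightarrow> y \<in> R \<Longrightarrow> f i x y \<in> R"
  obtains Q where "countable Q" "Q \<subseteq> R" "a \<in> Q" "\<And>i x y. x \<in> Q \<Longrightarrow> y \<in> Q \<Longrightarrow> f i x y \<in> Q"
proof -
  define S where "S = rec_nat {a} (\<lambda>_ S. S \<union> (\<lambda>(i, x, y). f i x y) ` (UNIV \<times> S \<times> S))"
  have S: "S 0 = {a}" "\<And>n. S (Suc n) = S n \<union> (\<lambda>(i, x, y). f i x y) ` (UNIV \<times> S n \<times> S n)"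
    by (simp_all add: S_def)
  have "countable (S n) \<and> S n \<subseteq> R" for n
    by (induction n) (use assms in \<open>auto simp: S\<close>)
  then have "countable (\<Union>n. S n)" "(\<Union>n. S n) \<subseteq> R" by auto
  moreover have "f i x y \<in> (\<Union>n. S n)" if xy: "x \<in> (\<Union>n. S n)" "y \<in> (\<Union>n. S n)" for i x y
  proof -
    obtain m n where mn: "x \<in> S m" "y \<in> S n" using xy by blast
    have "S k \<subseteq> S (max m n)" if "k \<le> max m n" for k
      using _ that by (rule lift_Suc_mono_le) (simp add: S)
    from this[of m] this[of n] mn have "(i, x, y) \<in> UNIV \<times> S (max m n) \<times> S (max m n)" by auto
    then have "f i x y \<in> S (Suc (max m n))" unfolding S(2) by force
    then show ?thesis by blast
  qed
  ultimately show thesis using S(1) by (intro that[of "\<Union>n. S n"]) auto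
qed

lemma ex_base: "\<exists>b :: nat \<Rightarrow> 'a::second_countable_topology set.
    (\<forall>n. open (b n)) \<and> (\<forall>U x. open U \<and> x \<in> U \<longrightarrow> (\<exists>n. x \<in> b n \<and> b n \<subseteq> U))"
proof -
  obtain B :: "'a set set" where B: "countable B" "topological_basis B"
    using ex_countable_basis by blast
  have ne: "B \<noteq> {}" using topological_basisE[OF B(2) open_UNIV] by blast
  show ?thesis
  proof (intro exI[of _ "from_nat_into B"] conjI allI impI)
    show "open (from_nat_into B n)" for n
      using B(2) ne by (simp add: from_nat_into topological_basis_open)
    fix U and x :: 'a assume "open U \<and> x \<in> U"
    then obtain V where "V \<in> B" "x \<in> V" "V \<subseteq> U"
      using topological_basisE[OF B(2)] by metis
    then show "\<exists>n. x \<in> from_nat_into B n \<and> from_nat_into B n \<subseteq> U"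
      using from_nat_into_surj[OF B(1)] by metis
  qed
qed

text \<open>The base is numbered so that a requirement can name a basic set by a natural
  number.\<close>

definition base :: "nat \<Rightarrow> 'a::second_countable_topology set" where
  "base = (SOME b. (\<forall>n. open (b n)) \<and> (\<forall>U x. open U \<and> x \<in> U \<longrightarrow> (\<exists>n. x \<in> b n \<and> b n \<subseteq> U)))"

lemma base_spec:
  "(\<forall>n. open (base n :: 'a::second_countable_topology set)) \<and>
   (\<forall>U x. open U \<and> x \<in> U \<longrightarrow> (\<exists>n. x \<in> base n \<and> base n \<subseteq> (U :: 'a set)))"
  unfolding base_def by (rule someI_ex[OF ex_base])

lemma open_base: "open (base n)"
  using base_spec by metis

lemma base_neighbourhood: "open U \<Longrightarrow> x \<in> U \<Longrightarrow> \<exists>n. x \<in> base n \<and> base n \<subseteq> U"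
  using base_spec by metis

definition suslin_code :: "'a::topological_space set \<Rightarrow> ('a \<times> (nat \<Rightarrow> nat)) set" where
  "suslin_code A = (SOME F. closed F \<and> A = fst ` F)"

lemma suslin_code: "suslin A \<Longrightarrow> closed (suslin_code A) \<and> A = fst ` suslin_code A"
  unfolding suslin_def suslin_code_def by (rule someI_ex)

lemma closed_suslin_code: "suslin A \<Longrightarrow> closed (suslin_code A)"
  using suslin_code by (rule conjunct1)

lemma image_suslin_code: "suslin A \<Longrightarrow> fst ` suslin_code A = A"
  using suslin_code by (rule conjunct2[THEN sym])

text \<open>Requirements are finite data, so a countable family of conditions can meet them all.
  \<open>Split\<close> decides a coordinate of a witness, \<open>Shrink\<close> bounds a diameter,
  \<open>Edge\<close> enters a set of edge starts, and \<open>Local\<close> enters a basic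
  set.\<close>

datatype requirement = Split "nat list" | Shrink nat | Edge nat | Local nat

instance requirement :: countable
  by countable_datatype

text \<open>\<open>\<Phi> k\<close> abstracts the starts of edges whose later points lie in the
  closure of the argument; the fusion knows edges only through these three properties.\<close>

locale suslin_closure_family =
  fixes \<Phi> :: "nat \<Rightarrow> 'a::polish_space set \<Rightarrow> 'a set"
  assumes Phi_mono: "A \<subseteq> B \<Longrightarrow> \<Phi> k A \<subseteq> \<Phi> k B"
    and Phi_closure: "\<Phi> k (closure A) = \<Phi> k A"
    and suslin_Phi: "suslin (\<Phi> k A)"
begin

section \<open>The ideal of small sets\<close>

definition small :: "'a set \<Rightarrow> bool" where
  "small A \<longleftrightarrow> (\<exists>\<B>. countable \<B> \<and> (\<forall>B \<in> \<B>. B \<in> sets borel \<and> (\<exists>k. B \<inter> \<Phi> k B = {})) \<and> A \<subseteq> \<Union>\<B>)"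

lemma small_subset: "small B \<Longrightarrow> A \<subseteq> B \<Longrightarrow> small A"
  unfolding small_def by (meson order_trans)

lemma small_empty: "small {}"
  unfolding small_def by (intro exI[of _ "{}"]) auto

lemma small_UN:
  assumes "countable I" "\<And>i. i \<in> I \<Longrightarrow> small (A i)"
  shows "small (\<Union>i\<in>I. A i)"
proof -
  obtain \<B> where \<B>: "\<And>i. i \<in> I \<Longrightarrow> countable (\<B> i) \<and>
      (\<forall>B \<in> \<B> i. B \<in> sets borel \<and> (\<exists>k. B \<inter> \<Phi> k B = {})) \<and> A i \<subseteq> \<Union>(\<B> i)"
    using assms(2) unfolding small_def by metis
  show ?thesis unfolding small_def
  proof (intro exI[of _ "\<Union>i\<in>I. \<B> i"] conjI)
    show "countable (\<Union>i\<in>I. \<B> i)" using assms(1) \<B> by simp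
    show "\<forall>B \<in> \<Union>i\<in>I. \<B> i. B \<in> sets borel \<and> (\<exists>k. B \<inter> \<Phi> k B = {})" using \<B> by simp
    show "(\<Union>i\<in>I. A i) \<subseteq> \<Union>(\<Union>i\<in>I. \<B> i)"
    proof
      fix x assume "x \<in> (\<Union>i\<in>I. A i)"
      then obtain i where "i \<in> I" "x \<in> A i" by blast
      then show "x \<in> \<Union>(\<Union>i\<in>I. \<B> i)" using \<B>[of i] by blast
    qed
  qed
qed

lemma small_Un: "small A \<Longrightarrow> small B \<Longrightarrow> small (A \<union> B)"
  using small_UN[of "{A, B}" id] by auto

lemma small_borel_cover:
  assumes "small A"
  obtains Z where "Z \<in> sets borel" "small Z" "A \<subseteq> Z"
proof -
  obtain \<B> where \<B>: "countable \<B>" "\<forall>B \<in> \<B>. B \<in> sets borel \<and> (\<exists>k. B \<inter> \<Phi> k B = {})" "A \<subseteq> \<Union>\<B>"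
    using assms unfolding small_def by blast
  show thesis
  proof (rule that)
    show "\<Union>\<B> \<in> sets borel" using \<B> by (intro sets.countable_Union) auto
    show "small (\<Union>\<B>)" using \<B> unfolding small_def by blast
  qed (rule \<B>)
qed

text \<open>Lusin separation gives a Borel \<open>S\<close> around \<open>K\<close> missing
  \<open>\<Phi> k K\<close>. Cutting \<open>S\<close> down to \<open>closure K\<close> adds nothing
  to the edge starts, so the resulting Borel set is again an anticlique.\<close>

lemma small_suslin_anticlique:
  assumes "suslin K" "K \<inter> \<Phi> k K = {}"
  shows "small K"
proof -
  obtain S where S: "S \<in> sets borel" "K \<subseteq> S" "S \<inter> \<Phi> k K = {}"
    using lusin_separation[OF assms(1) suslin_Phi assms(2)] unfolding borel_separated_def by blast
  have "\<Phi> k (S \<inter> closure K) \<subseteq> \<Phi> k K"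
    using Phi_mono[of "S \<inter> closure K" "closure K" k] Phi_closure by auto
  then have "(S \<inter> closure K) \<inter> \<Phi> k (S \<inter> closure K) = {}" using S(3) by blast
  moreover have "S \<inter> closure K \<in> sets borel" using S(1) by auto
  moreover have "K \<subseteq> S \<inter> closure K" using S(2) closure_subset by auto
  ultimately show ?thesis unfolding small_def
    by (intro exI[of _ "{S \<inter> closure K}"]) auto
qed

text \<open>
  The part of \<open>p\<close> all of whose relative neighbourhoods are positive. A set of generic points that
  meets every condition below \<open>p\<close> is dense in \<open>core p\<close>, so \<open>\<Phi> k\<close> cannot tell the two apart.
\<close>

definition core :: "'a set \<Rightarrow> 'a set" where
  "core p = p - (\<Union>m\<in>{m. small (p \<inter> base m)}. base m)"

lemma suslin_core: "suslin p \<Longrightarrow> suslin (core p)"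
  unfolding core_def Diff_eq
  by (rule suslin_Int) (auto intro!: suslin_closed open_base)

lemma small_minus_core: "small (p - core p)"
proof -
  have "small (\<Union>m\<in>{m. small (p \<inter> base m)}. p \<inter> base m)"
    by (rule small_UN) auto
  then show ?thesis by (rule small_subset) (auto simp: core_def)
qed

section \<open>Requirements, rich and saturated families\<close>

definition splitting :: "'a set \<Rightarrow> nat list \<Rightarrow> 'a set set" where
  "splitting p s = {q. q \<inter> branch (suslin_code p) s = {} \<or>
     (\<exists>j. q \<subseteq> branch (suslin_code p) (s @ [j]))}"

fun fulfils :: "requirement \<Rightarrow> 'a set \<Rightarrow> 'a set \<Rightarrow> 'a set \<Rightarrow> bool" where
  "fulfils (Split s) p q q' \<longleftrightarrow> q' \<in> splitting p s"
| "fulfils (Shrink n) p q q' \<longleftrightarrow> (\<forall>x \<in> q'. \<forall>y \<in> q'. dist x y \<le> (1 / 2) ^ n)"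
| "fulfils (Edge k) p q q' \<longleftrightarrow> q' \<subseteq> \<Phi> k (core q)"
| "fulfils (Local m) p q q' \<longleftrightarrow> small (q \<inter> base m) \<or> q' \<subseteq> base m"

text \<open>The common interface of the two kinds of conditions, positive Suslin sets and positive
  Borel sets: it suffices for meeting every requirement.\<close>

definition rich :: "'a set set \<Rightarrow> bool" where
  "rich R \<longleftrightarrow> (\<forall>p \<in> R. suslin p \<and> \<not> small p) \<and>
     (\<forall>p \<in> R. \<forall>A. suslin A \<and> \<not> small (p \<inter> A) \<longrightarrow> (\<exists>q \<in> R. q \<subseteq> p \<inter> A))"

lemma rich_cover:
  assumes "rich R" "q \<in> R" "q \<subseteq> (\<Union>n::nat. A n)" "\<And>n. suslin (A n)"
  shows "\<exists>n. \<exists>q' \<in> R. q' \<subseteq> q \<inter> A n"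
proof -
  have "\<exists>n. \<not> small (q \<inter> A n)"
  proof (rule ccontr)
    assume "\<not> ?thesis"
    then have "small (\<Union>n. q \<inter> A n)" by (intro small_UN) auto
    then have "small q" by (rule small_subset) (use assms(3) in auto)
    then show False using assms(1,2) unfolding rich_def by blast
  qed
  then show ?thesis using assms unfolding rich_def by blast
qed

text \<open>\<open>A\<close> is first enlarged to a small Borel set, whose complement is Suslin as
  richness demands.\<close>

lemma rich_minus_small:
  assumes "rich R" "q \<in> R" "small A"
  shows "\<exists>q' \<in> R. q' \<subseteq> q - A"
proof -
  obtain Z where Z: "Z \<in> sets borel" "small Z" "A \<subseteq> Z" using small_borel_cover assms(3) by blast
  have "\<not> small (q \<inter> - Z)"
  proof
    assume "small (q \<inter> - Z)"
    then have "small ((q \<inter> - Z) \<union> Z)" using Z(2) by (rule small_Un)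
    then have "small q" by (rule small_subset) auto
    then show False using assms(1,2) unfolding rich_def by blast
  qed
  moreover have "suslin (- Z)" using Z(1) by (intro suslin_borel) auto
  ultimately obtain q' where "q' \<in> R" "q' \<subseteq> q \<inter> - Z" using assms(1,2) unfolding rich_def by blast
  then show ?thesis using Z(3) by blast
qed

lemma rich_fulfils:
  assumes R: "rich R" and pq: "p \<in> R" "q \<in> R"
  shows "\<exists>q' \<in> R. q' \<subseteq> q \<and> fulfils r p q q'"
proof (cases r)
  case (Split s)
  let ?b = "branch (suslin_code p)"
  have sus: "suslin (?b s)" for s
    using R pq(1) unfolding rich_def by (intro suslin_branch closed_suslin_code) simp
  show ?thesis
  proof (cases "small (q \<inter> ?b s)")
    case True
    then obtain q' where "q' \<in> R" "q' \<subseteq> q - (q \<inter> ?b s)" using rich_minus_small[OF R pq(2)] by blast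
    then show ?thesis unfolding Split by (intro bexI[of _ q']) (auto simp: splitting_def)
  next
    case False
    then obtain q1 where q1: "q1 \<in> R" "q1 \<subseteq> q \<inter> ?b s" using R pq(2) sus unfolding rich_def by blast
    then have "q1 \<subseteq> (\<Union>j. ?b (s @ [j]))" using branch_split[of "suslin_code p" s] by blast
    then obtain j q' where "q' \<in> R" "q' \<subseteq> q1 \<inter> ?b (s @ [j])" using rich_cover[OF R q1(1)] sus by metis
    then show ?thesis unfolding Split using q1(2) by (intro bexI[of _ q']) (auto simp: splitting_def)
  qed
next
  case (Shrink n)
  obtain K :: "nat \<Rightarrow> 'a set" where K: "\<And>i. closed (K i)"
      "\<And>i. \<forall>x\<in>K i. \<forall>y\<in>K i. dist x y \<le> (1 / 2) ^ n" "(\<Union>i. K i) = UNIV"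
    using small_closed_cover[of "(1 / 2) ^ n", where 'a = 'a] by (simp, blast)
  then obtain i q' where "q' \<in> R" "q' \<subseteq> q \<inter> K i"
    using rich_cover[OF R pq(2), of K] suslin_closed by (metis subset_UNIV)
  then show ?thesis unfolding Shrink using K(2)[of i] by (intro bexI[of _ q']) auto
next
  case (Edge k)
  have sus: "suslin q" and ns: "\<not> small q" using R pq unfolding rich_def by auto
  \<comment> \<open>If a small Borel \<open>Z\<close> covered this set, \<open>core q - Z\<close>
    would be a Suslin anticlique, hence small. Together with \<open>Z\<close> and
    \<open>q - core q\<close> it would cover \<open>q\<close> by small sets.\<close>
  have "\<not> small (q \<inter> \<Phi> k (core q))"
  proof
    assume "small (q \<inter> \<Phi> k (core q))"
    then obtain Z where Z: "Z \<in> sets borel" "small Z" "q \<inter> \<Phi> k (core q) \<subseteq> Z"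
      using small_borel_cover by blast
    have "core q \<subseteq> q" by (auto simp: core_def)
    moreover have "\<Phi> k (core q - Z) \<subseteq> \<Phi> k (core q)" by (rule Phi_mono) auto
    ultimately have "(core q - Z) \<inter> \<Phi> k (core q - Z) = {}" using Z(3) by blast
    moreover have "suslin (core q - Z)"
      unfolding Diff_eq using sus Z(1) by (auto intro!: suslin_Int suslin_core intro: suslin_borel)
    ultimately have "small (core q - Z)" by (rule small_suslin_anticlique[rotated])
    then have "small ((core q - Z) \<union> (Z \<union> (q - core q)))"
      by (intro small_Un Z(2) small_minus_core)
    then show False using ns small_subset by blast
  qed
  then obtain q' where "q' \<in> R" "q' \<subseteq> q \<inter> \<Phi> k (core q)"
    using R pq(2) suslin_Phi unfolding rich_def by blast
  then show ?thesis unfolding Edge by (intro bexI[of _ q']) auto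
next
  case (Local m)
  show ?thesis
  proof (cases "small (q \<inter> base m)")
    case True
    then show ?thesis unfolding Local using pq(2) by auto
  next
    case False
    then obtain q' where "q' \<in> R" "q' \<subseteq> q \<inter> base m"
      using R pq(2) suslin_open[OF open_base] unfolding rich_def by blast
    then show ?thesis unfolding Local by (intro bexI[of _ q']) auto
  qed
qed

text \<open>The share of closure under a submodel that the fusion needs: \<open>p\<close> supplies
  the code to be followed, and \<open>q\<close> is the condition to be strengthened.\<close>

definition saturated :: "'a set set \<Rightarrow> bool" where
  "saturated Q \<longleftrightarrow> (\<forall>r. \<forall>p \<in> Q. \<forall>q \<in> Q. \<exists>q' \<in> Q. q' \<subseteq> q \<and> fulfils r p q q')"

text \<open>If every condition of \<open>Q\<close> below \<open>q\<close> met \<open>W\<close>, the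
  \<open>Local\<close> requirements would make \<open>W\<close> dense in \<open>core q\<close>,
  whence \<open>\<Phi> k (core q) \<subseteq> \<Phi> k W\<close>. The \<open>Edge\<close>
  requirement then yields a condition inside \<open>\<Phi> k W\<close>, which is disjoint from
  \<open>W\<close>.\<close>

lemma saturated_avoid:
  assumes "saturated Q" "q \<in> Q" "W \<inter> \<Phi> k W = {}"
  shows "\<exists>q' \<in> Q. q' \<subseteq> q \<and> q' \<inter> W = {}"
proof (rule ccontr)
  assume neg: "\<not> ?thesis"
  have "x \<in> closure W" if "x \<in> core q" for x
    unfolding closure_iff_nhds_not_empty
  proof (intro allI impI)
    fix A U assume "U \<subseteq> A" "x \<in> U" "open U"
    then obtain m where m: "x \<in> base m" "base m \<subseteq> A" using base_neighbourhood[of U x] by blast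
    then have "\<not> small (q \<inter> base m)" using that by (auto simp: core_def)
    moreover obtain q' where "q' \<in> Q" "q' \<subseteq> q" "fulfils (Local m) q q q'"
      using assms(1,2) unfolding saturated_def by blast
    ultimately show "W \<inter> A \<noteq> {}" using neg m(2) by fastforce
  qed
  then have "\<Phi> k (core q) \<subseteq> \<Phi> k W"
    using Phi_mono[of "core q" "closure W" k] Phi_closure by blast
  moreover obtain q' where "q' \<in> Q" "q' \<subseteq> q" "fulfils (Edge k) q q q'"
    using assms(1,2) unfolding saturated_def by blast
  ultimately show False using neg assms(3) by fastforce
qed

text \<open>Given a cover by anticliques, a descending sequence avoids them one by one on the set of
  generic points and enters every set of \<open>\<D>\<close>. The splitting sets are enumerated
  along with \<open>\<D>\<close>, so that the limit belongs to all conditions of the sequence and is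
  a generic point left uncovered.\<close>

lemma generic_points_not_small:
  assumes Q: "countable Q" "saturated Q" "\<And>q. q \<in> Q \<Longrightarrow> suslin q \<and> \<not> small q"
    and D: "countable \<D>" "\<And>D q. D \<in> \<D> \<Longrightarrow> q \<in> Q \<Longrightarrow> \<exists>d \<in> D \<inter> Q. d \<subseteq> q"
    and p: "p \<in> Q"
  shows "\<not> small {x \<in> p. \<forall>D \<in> \<D>. \<exists>d \<in> D \<inter> Q. x \<in> d}"
proof
  define C where "C = {x \<in> p. \<forall>D \<in> \<D>. \<exists>d \<in> D \<inter> Q. x \<in> d}"
  assume "small {x \<in> p. \<forall>D \<in> \<D>. \<exists>d \<in> D \<inter> Q. x \<in> d}"
  then have "small C" by (simp add: C_def)
  then obtain \<B> where \<B>: "countable \<B>" "\<forall>B \<in> \<B>. \<exists>k. B \<inter> \<Phi> k B = {}" "C \<subseteq> \<Union>\<B>"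
    unfolding small_def by blast
  \<comment> \<open>The empty set is an anticlique here and makes the enumeration total even when
    the cover is empty.\<close>
  define B where "B = from_nat_into (insert {} \<B>)"
  have B: "\<exists>k. B n \<inter> \<Phi> k (B n) = {}" for n
  proof -
    have "B n \<in> insert {} \<B>" unfolding B_def by (rule from_nat_into) simp
    then show ?thesis using \<B>(2) by blast
  qed
  have C_B: "C \<subseteq> (\<Union>n. B n)"
  proof -
    have "range B = insert {} \<B>" unfolding B_def by (rule range_from_nat_into) (use \<B>(1) in auto)
    then show ?thesis using \<B>(3) by auto
  qed
  define splits where "splits = (\<lambda>(p, s). splitting p s) ` (Q \<times> UNIV)"
  \<comment> \<open>\<open>UNIV\<close> is a harmless further dense set that keeps the enumerated
    collection nonempty.\<close>
  define E where "E = from_nat_into (insert UNIV (\<D> \<union> splits))"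
  have E_countable: "countable (insert UNIV (\<D> \<union> splits))"
    using D(1) Q(1) by (auto simp: splits_def)
  have E_surj: "\<exists>n. E n = D" if "D \<in> \<D> \<union> splits" for D
    using that E_countable unfolding E_def by (intro from_nat_into_surj) auto
  have E_dense: "\<exists>d \<in> E n \<inter> Q. d \<subseteq> q" if "q \<in> Q" for n q
  proof -
    have "E n \<in> insert UNIV (\<D> \<union> splits)" unfolding E_def by (rule from_nat_into) simp
    then consider "E n = UNIV" | "E n \<in> \<D>" | p s where "p \<in> Q" "E n = splitting p s"
      unfolding splits_def by auto
    then show ?thesis
    proof cases
      case 3
      then obtain q' where "q' \<in> Q" "q' \<subseteq> q" "fulfils (Split s) p q q'"
        using Q(2) \<open>q \<in> Q\<close> unfolding saturated_def by blast
      then show ?thesis using 3(2) by auto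
    qed (use D(2) that in auto)
  qed
  have step: "\<exists>q' \<in> Q. q' \<subseteq> q \<and> q' \<in> E n \<and> q' \<inter> (C \<inter> B n) = {} \<and>
      (\<forall>x \<in> q'. \<forall>y \<in> q'. dist x y \<le> (1 / 2) ^ n)" if q_in: "q \<in> Q" for q n
  proof -
    obtain k where k: "B n \<inter> \<Phi> k (B n) = {}" using B by blast
    then have "(C \<inter> B n) \<inter> \<Phi> k (C \<inter> B n) = {}" using Phi_mono[of "C \<inter> B n" "B n" k] by blast
    then obtain q1 where q1: "q1 \<in> Q" "q1 \<subseteq> q" "q1 \<inter> (C \<inter> B n) = {}"
      using saturated_avoid[OF Q(2) q_in] by blast
    obtain q2 where q2: "q2 \<in> Q" "q2 \<subseteq> q1" "fulfils (Shrink n) q1 q1 q2"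
      using Q(2) q1(1) unfolding saturated_def by blast
    obtain q3 where q3: "q3 \<in> Q" "q3 \<in> E n" "q3 \<subseteq> q2" using E_dense[OF q2(1)] by blast
    have "\<forall>x \<in> q3. \<forall>y \<in> q3. dist x y \<le> (1 / 2) ^ n" using q2(3) q3(3) by auto
    then show ?thesis using q1 q2 q3 by (intro bexI[of _ q3]) blast+
  qed
  have "\<exists>q. \<forall>n. (q n \<in> Q \<and> (n = 0 \<longrightarrow> q n = p)) \<and> (q (Suc n) \<subseteq> q n \<and> q (Suc n) \<in> E n \<and>
      q (Suc n) \<inter> (C \<inter> B n) = {} \<and> (\<forall>x \<in> q (Suc n). \<forall>y \<in> q (Suc n). dist x y \<le> (1 / 2) ^ n))"
  proof (rule dependent_nat_choice)
    show "\<exists>x. x \<in> Q \<and> (0 = (0::nat) \<longrightarrow> x = p)" using p by blast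
    show "\<exists>y. (y \<in> Q \<and> (Suc n = 0 \<longrightarrow> y = p)) \<and> (y \<subseteq> x \<and> y \<in> E n \<and>
        y \<inter> (C \<inter> B n) = {} \<and> (\<forall>u \<in> y. \<forall>v \<in> y. dist u v \<le> (1 / 2) ^ n))"
      if "x \<in> Q \<and> (n = 0 \<longrightarrow> x = p)" for x n
      using step[of x n] that by blast
  qed
  then obtain q where q: "\<And>n. q n \<in> Q" "q 0 = p" "\<And>n. q (Suc n) \<subseteq> q n" "\<And>n. q (Suc n) \<in> E n"
      "\<And>n. q (Suc n) \<inter> (C \<inter> B n) = {}"
      "\<And>n x y. x \<in> q (Suc n) \<Longrightarrow> y \<in> q (Suc n) \<Longrightarrow> dist x y \<le> (1 / 2) ^ n"
    by metis
  have ne: "q n \<noteq> {}" for n using q(1) Q(3) small_empty by metis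
  have q_anti: "q n \<subseteq> q m" if "m \<le> n" for m n
    using q(3) that by (rule lift_Suc_antimono_le)
  obtain x where x: "\<And>n. x \<in> closure (q n)"
    using nested_closures_meet[of q] ne q(3,6) by blast
  \<comment> \<open>Once the sequence is inside a branch \<open>s\<close> of the code of
    \<open>q i\<close>, the stage entering \<open>splitting (q i) s\<close> cannot miss that branch,
    since a later nonempty condition lies in both. So it decides the next coordinate, and the
    decisions form a witness for \<open>x\<close>.\<close>
  have x_in: "x \<in> q i" for i
  proof -
    let ?F = "suslin_code (q i)"
    have sus: "suslin (q i)" using q(1) Q(3) by blast
    have "\<exists>n. q n \<subseteq> branch ?F []"
      using image_suslin_code[OF sus] by (auto simp: branch_Nil)
    moreover have "\<exists>j n. q n \<subseteq> branch ?F (s @ [j])" if s: "\<exists>n. q n \<subseteq> branch ?F s" for s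
    proof -
      obtain n where n: "q n \<subseteq> branch ?F s" using s by blast
      have "splitting (q i) s \<in> splits"
        using q(1) unfolding splits_def by force
      then obtain k where "E k = splitting (q i) s"
        using E_surj by blast
      then have "q (Suc k) \<in> splitting (q i) s" using q(4)[of k] by simp
      moreover have "q (max n (Suc k)) \<subseteq> q (Suc k) \<inter> branch ?F s"
        using n q_anti[of n "max n (Suc k)"] q_anti[of "Suc k" "max n (Suc k)"] by force
      then have "q (Suc k) \<inter> branch ?F s \<noteq> {}" using ne[of "max n (Suc k)"] by blast
      ultimately show ?thesis by (auto simp: splitting_def)
    qed
    ultimately obtain y where y: "\<And>m. \<exists>n. q n \<subseteq> branch ?F (map y [0..<m])"
      using infinite_branch[of "\<lambda>s. \<exists>n. q n \<subseteq> branch ?F s"] by blast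
    have "x \<in> closure (branch ?F (map y [0..<m]))" for m
      using x y[of m] closure_mono by blast
    then have "(x, y) \<in> ?F" by (rule branch_limit[OF closed_suslin_code[OF sus]])
    then show ?thesis using image_suslin_code[OF sus] by force
  qed
  have "x \<in> C"
    unfolding C_def
  proof (intro CollectI conjI ballI)
    show "x \<in> p" using x_in[of 0] q(2) by simp
    fix D assume "D \<in> \<D>"
    then obtain n where "E n = D" using E_surj by blast
    then show "\<exists>d \<in> D \<inter> Q. x \<in> d" using q(1,4) x_in by blast
  qed
  moreover from this obtain n where "x \<in> B n" using C_B by blast
  ultimately show False using q(5)[of n] x_in[of "Suc n"] by blast
qed

section \<open>From Suslin conditions to Borel conditions\<close>

lemma rich_suslin: "rich {p. suslin p \<and> \<not> small p}"
  unfolding rich_def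
proof (intro conjI ballI allI impI)
  fix p A assume "p \<in> {p. suslin p \<and> \<not> small p}" "suslin A \<and> \<not> small (p \<inter> A)"
  then have "p \<inter> A \<in> {p. suslin p \<and> \<not> small p}" by (simp add: suslin_Int)
  then show "\<exists>q \<in> {p. suslin p \<and> \<not> small p}. q \<subseteq> p \<inter> A" by blast
qed simp_all

text \<open>
  The generic points below \<open>E\<close> form a positive set. A Borel set between them and \<open>E\<close> is obtained by
  separating each branch \<open>b s\<close> of \<open>E\<close> from the union of the conditions disjoint from it: a generic
  point in the separating set of \<open>b s\<close> lies in the separating set of some \<open>b (s @ [j])\<close>, and the limit
  of the closures of the branches is a witness for membership in \<open>E\<close>.
\<close>

theorem not_small_suslin_contains_borel:
  assumes "suslin E" "\<not> small E"
  shows "\<exists>C \<in> sets borel. C \<subseteq> E \<and> \<not> small C"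
proof -
  define R where "R = {p. suslin p \<and> \<not> small p}"
  have R: "rich R" "E \<in> R" using rich_suslin assms by (simp_all add: R_def)
  have "\<forall>r p q. \<exists>q'. p \<in> R \<and> q \<in> R \<longrightarrow> q' \<in> R \<and> q' \<subseteq> q \<and> fulfils r p q q'"
    using rich_fulfils[OF R(1)] by blast
  then obtain f where
    f: "\<And>r p q. p \<in> R \<Longrightarrow> q \<in> R \<Longrightarrow> f r p q \<in> R \<and> f r p q \<subseteq> q \<and> fulfils r p q (f r p q)"
    by metis
  obtain Q where Q: "countable Q" "Q \<subseteq> R" "E \<in> Q" "\<And>r p q. p \<in> Q \<Longrightarrow> q \<in> Q \<Longrightarrow> f r p q \<in> Q"
    using countable_closure_binary[of E R f] R(2) f by metis
  have sat: "saturated Q" using Q(2,4) f unfolding saturated_def by (metis subsetD)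
  have Q_suslin: "suslin q \<and> \<not> small q" if "q \<in> Q" for q using that Q(2) by (auto simp: R_def)
  define b where "b = branch (suslin_code E)"
  have sus: "suslin (b s)" for s
    unfolding b_def by (intro suslin_branch closed_suslin_code assms(1))
  \<comment> \<open>A countable union of Suslin sets, because \<open>Q\<close> is countable; this
    makes it accessible to Lusin separation.\<close>
  define U where "U s = (\<Union>q\<in>{q \<in> Q. q \<inter> b s = {}}. q)" for s
  have "\<exists>T \<in> sets borel. b s \<subseteq> T \<and> T \<inter> U s = {}" for s
  proof -
    have "suslin (U s)"
      unfolding U_def using Q_suslin by (intro suslin_UN_countable) (auto intro: countable_subset[OF _ Q(1)])
    then have "borel_separated (b s) (U s)"
      by (rule lusin_separation[OF sus]) (auto simp: U_def)
    then show ?thesis unfolding borel_separated_def by blast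
  qed
  then obtain T where T: "\<And>s. T s \<in> sets borel" "\<And>s. b s \<subseteq> T s"
      and T_disjoint: "\<And>s. T s \<inter> U s = {}"
    by metis
  \<comment> \<open>The trace on \<open>closure (b s)\<close> keeps the separating set close enough
    to the branch for the limit argument.\<close>
  define S where "S s = T s \<inter> closure (b s)" for s
  have S_borel: "S s \<in> sets borel" for s using T(1) by (auto simp: S_def)
  have b_S: "b s \<subseteq> S s" for s using T(2) closure_subset by (auto simp: S_def)
  define C where "C = S [] \<inter> (\<Inter>s. - S s \<union> (\<Union>j. S (s @ [j])))"
  let ?\<D> = "range (splitting E)"
  let ?G = "{x \<in> E. \<forall>D \<in> ?\<D>. \<exists>d \<in> D \<inter> Q. x \<in> d}"
  have "\<not> small ?G"
  proof (rule generic_points_not_small[OF Q(1) sat _ _ _ Q(3)])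
    fix D q assume "D \<in> ?\<D>" "q \<in> Q"
    then obtain s where s: "D = splitting E s" by blast
    obtain q' where "q' \<in> Q" "q' \<subseteq> q" "fulfils (Split s) E q q'"
      using sat Q(3) \<open>q \<in> Q\<close> unfolding saturated_def by meson
    then show "\<exists>d \<in> D \<inter> Q. d \<subseteq> q" unfolding s by auto
  qed (use Q_suslin in auto)
  moreover have "?G \<subseteq> C"
  proof
    fix x assume x: "x \<in> ?G"
    have "x \<in> S []" using x b_S[of "[]"] image_suslin_code[OF assms(1)] by (auto simp: b_def branch_Nil)
    moreover have "\<exists>j. x \<in> S (s @ [j])" if "x \<in> S s" for s
    proof -
      obtain d where d: "d \<in> Q" "x \<in> d" "d \<in> splitting E s" using x by blast
      \<comment> \<open>Were \<open>d\<close> disjoint from \<open>b s\<close>, it would be part of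
        \<open>U s\<close>, which \<open>T s\<close> avoids. Hence \<open>d\<close> decides the next
        coordinate.\<close>
      then have "d \<inter> b s \<noteq> {}" using T_disjoint[of s] \<open>x \<in> S s\<close> by (auto simp: S_def U_def)
      then show ?thesis using d b_S unfolding splitting_def b_def by blast
    qed
    ultimately show "x \<in> C" by (auto simp: C_def)
  qed
  ultimately have "\<not> small C" by (metis (lifting) small_subset)
  moreover have "C \<subseteq> E"
  proof
    fix x assume x: "x \<in> C"
    obtain y where "\<And>m. x \<in> S (map y [0..<m])"
    proof (rule infinite_branch[of "\<lambda>s. x \<in> S s"])
      show "x \<in> S []" using x by (simp add: C_def)
      show "\<exists>j. x \<in> S (s @ [j])" if "x \<in> S s" for s using x that by (auto simp: C_def)
    qed blast
    then have "(x, y) \<in> suslin_code E"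
      by (intro branch_limit closed_suslin_code assms(1)) (auto simp: S_def b_def)
    then show "x \<in> E" using image_suslin_code[OF assms(1)] by force
  qed
  moreover have "C \<in> sets borel"
    unfolding C_def using S_borel
    by (intro sets.Int sets.countable_INT image_subsetI sets.Un sets.countable_UN) auto
  ultimately show ?thesis by blast
qed

text \<open>An \<open>Edge\<close> requirement asks for a condition inside a set that is merely
  Suslin; the preceding theorem supplies a Borel one.\<close>

lemma rich_borel: "rich {B. B \<in> sets borel \<and> \<not> small B}"
  unfolding rich_def
proof (intro conjI ballI allI impI)
  fix p A assume "p \<in> {B. B \<in> sets borel \<and> \<not> small B}" "suslin A \<and> \<not> small (p \<inter> A)"
  then have "suslin (p \<inter> A)" "\<not> small (p \<inter> A)" by (auto intro: suslin_Int suslin_borel)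
  then obtain q where "q \<in> sets borel" "q \<subseteq> p \<inter> A" "\<not> small q"
    using not_small_suslin_contains_borel by blast
  then show "\<exists>q \<in> {B. B \<in> sets borel \<and> \<not> small B}. q \<subseteq> p \<inter> A" by auto
qed (simp_all add: suslin_borel)

end

section \<open>Nearly open hypergraphs\<close>

text \<open>The closure is built in, so the set visibly depends on \<open>closure S\<close> only.
  The empty edge is excluded because it has no first point.\<close>

definition edge_starts :: "'a::topological_space sequence set \<Rightarrow> 'a set \<Rightarrow> 'a set" where
  "edge_starts G S =
     {x. \<exists>(n, e) \<in> G. n \<noteq> 0 \<and> e 0 = x \<and> (\<forall>i \<in> seq_dom n - {0}. e i \<in> closure S)}"

lemma zero_in_seq_dom: "n \<noteq> 0 \<Longrightarrow> 0 \<in> seq_dom n"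
  by (simp add: seq_dom_def flip: zero_enat_def)

lemma edge_starts_mono: "A \<subseteq> B \<Longrightarrow> edge_starts G A \<subseteq> edge_starts G B"
  using closure_mono[of A B] unfolding edge_starts_def by (auto 0 3)

lemma edge_starts_closure: "edge_starts G (closure S) = edge_starts G S"
  by (simp add: edge_starts_def)

lemma sequences_0: "(0, e) \<in> sequences B \<longleftrightarrow> e = (\<lambda>_. undefined)"
  by (auto simp: sequences_def seq_dom_def)

text \<open>Near openness moves the later points of an edge from \<open>closure B\<close> into
  \<open>B\<close> while keeping its first point. The empty edge must be absent, since it is a
  sequence over every \<open>B\<close>.\<close>

lemma anticlique_iff:
  assumes "nearly_open G" "(0, \<lambda>_. undefined) \<notin> G"
  shows "anticlique G B \<longleftrightarrow> B \<inter> edge_starts G B = {}"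
proof
  assume anti: "anticlique G B"
  show "B \<inter> edge_starts G B = {}"
  proof (rule ccontr)
    assume "B \<inter> edge_starts G B \<noteq> {}"
    then obtain n e where e: "(n, e) \<in> G" "n \<noteq> 0" "e 0 \<in> B" "\<And>i. i \<in> seq_dom n - {0} \<Longrightarrow> e i \<in> closure B"
      unfolding edge_starts_def by auto
    have ext: "e \<in> extensional (seq_dom n)"
      using assms(1) e(1) by (auto simp: nearly_open_def analytic_hypergraph_def sequences_def PiE_def)
    have "\<forall>(n, e) \<in> G. \<exists>U. (\<forall>i \<in> seq_dom n - {0}. open (U i) \<and> e i \<in> U i) \<and>
        (\<forall>x. (\<forall>i \<in> seq_dom n - {0}. x i \<in> U i) \<longrightarrow>
          (n, \<lambda>i. if i \<in> seq_dom n - {0} then x i else e i) \<in> G)"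
      using assms(1) unfolding nearly_open_def by (rule conjunct2)
    from bspec[OF this e(1)] obtain U where
        U: "\<forall>i \<in> seq_dom n - {0}. open (U i) \<and> e i \<in> U i"
        "\<forall>x. (\<forall>i \<in> seq_dom n - {0}. x i \<in> U i) \<longrightarrow>
          (n, \<lambda>i. if i \<in> seq_dom n - {0} then x i else e i) \<in> G"
      unfolding prod.case by (elim exE conjE)
    have "\<exists>z. z \<in> U i \<inter> B" if "i \<in> seq_dom n - {0}" for i
      using bspec[OF U(1) that] e(4)[OF that] open_Int_closure_eq_empty[of "U i" B] by blast
    then obtain x where x: "\<And>i. i \<in> seq_dom n - {0} \<Longrightarrow> x i \<in> U i \<inter> B" by metis
    \<comment> \<open>Outside the domain the values of \<open>e\<close> are kept, so the modified
      edge remains extensional.\<close>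
    let ?e = "\<lambda>i. if i \<in> seq_dom n - {0} then x i else e i"
    have "(n, ?e) \<in> G" using x by (intro U(2)[rule_format]) blast
    moreover have "(n, ?e) \<in> sequences B"
      using x e(3) ext unfolding sequences_def PiE_def extensional_def by auto
    ultimately show False using anti unfolding anticlique_def by blast
  qed
next
  assume disj: "B \<inter> edge_starts G B = {}"
  have "(n, e) \<notin> G" if "(n, e) \<in> sequences B" for n e
  proof
    assume G: "(n, e) \<in> G"
    then have n: "n \<noteq> 0" using that assms(2) sequences_0[of e B] by metis
    have "e i \<in> B" if "i \<in> seq_dom n" for i
      using \<open>(n, e) \<in> sequences B\<close> that by (auto simp: sequences_def)
    then have "e 0 \<in> B" "\<forall>i \<in> seq_dom n - {0}. e i \<in> closure B"
      using zero_in_seq_dom[OF n] closure_subset[of B] by auto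
    then have "e 0 \<in> B" "e 0 \<in> edge_starts G B"
      using n G unfolding edge_starts_def by auto
    then show False using disj by blast
  qed
  then show "anticlique G B" unfolding anticlique_def by auto
qed

lemma openin_sequence_topology_slice:
  assumes "openin (product_topology (\<lambda>i. euclidean) (seq_dom n)) W"
  shows "openin sequence_topology ({n} \<times> W)"
proof -
  have "{n} \<times> W = (SIGMA m:UNIV. if m = n then W else {})" by (auto split: if_splits)
  then show ?thesis
    unfolding sequence_topology_def using assms by (simp add: openin_disjoint_union)
qed

text \<open>Coordinates are projections on a single summand of the sequence space, so the length is
  fixed along with the coordinate.\<close>

lemma open_component_preimage:
  fixes f :: "(nat \<Rightarrow> nat) \<Rightarrow> 'a::topological_space sequence"
  assumes f: "continuous_map euclidean sequence_topology f" and i: "i \<in> seq_dom n" and V: "open V"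
  shows "open {y. fst (f y) = n \<and> snd (f y) i \<in> V}"
proof -
  let ?W = "{n} \<times> {e \<in> seq_dom n \<rightarrow>\<^sub>E UNIV. e i \<in> V}"
  have "openin (product_topology (\<lambda>i. euclidean) (seq_dom n)) {e \<in> seq_dom n \<rightarrow>\<^sub>E UNIV. e i \<in> V}"
    using openin_continuous_map_preimage[OF continuous_map_product_projection[OF i, of "\<lambda>i. euclidean"], of V] V
    by simp
  then have "openin sequence_topology ?W"
    by (rule openin_sequence_topology_slice)
  from openin_continuous_map_preimage[OF f this] have "open {y. f y \<in> ?W}" by simp
  moreover have "f y \<in> sequences UNIV" for y
    using f by (auto simp: continuous_map_def topspace_sequence_topology)
  then have "snd (f y) \<in> seq_dom (fst (f y)) \<rightarrow>\<^sub>E UNIV" for y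
    by (auto simp: sequences_def mem_Times_iff dest!: meta_spec[of _ y])
  then have "f y \<in> ?W \<longleftrightarrow> fst (f y) = n \<and> snd (f y) i \<in> V" for y
    by (auto simp: mem_Times_iff)
  ultimately show ?thesis by simp
qed

lemma open_length_preimage:
  fixes f :: "(nat \<Rightarrow> nat) \<Rightarrow> 'a::topological_space sequence"
  assumes f: "continuous_map euclidean sequence_topology f"
  shows "open {y. fst (f y) = n}"
proof -
  let ?W = "{n} \<times> (seq_dom n \<rightarrow>\<^sub>E (UNIV :: 'a set))"
  have "openin (product_topology (\<lambda>i. euclidean) (seq_dom n)) (seq_dom n \<rightarrow>\<^sub>E (UNIV :: 'a set))"
    using openin_topspace[of "product_topology (\<lambda>i. euclidean) (seq_dom n)"] by simp
  then have "openin sequence_topology ?W"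
    by (rule openin_sequence_topology_slice)
  from openin_continuous_map_preimage[OF f this] have "open {y. f y \<in> ?W}" by simp
  moreover have "f y \<in> sequences UNIV" for y
    using f by (auto simp: continuous_map_def topspace_sequence_topology)
  then have "snd (f y) \<in> seq_dom (fst (f y)) \<rightarrow>\<^sub>E UNIV" for y
    by (auto simp: sequences_def mem_Times_iff dest!: meta_spec[of _ y])
  then have "f y \<in> ?W \<longleftrightarrow> fst (f y) = n" for y
    by (auto simp: mem_Times_iff)
  ultimately show ?thesis by simp
qed

text \<open>A parameter in Baire space for an edge serves as the witness. The relation is closed
  because the length is locally constant in the parameter and the demands on the points are
  closed.\<close>

lemma suslin_edge_starts:
  fixes G :: "'a::polish_space sequence set"
  assumes "analytic_hypergraph G"
  shows "suslin (edge_starts G S)"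
proof (cases "G = {}")
  case True
  then show ?thesis by (simp add: edge_starts_def suslin_closed)
next
  case False
  then obtain f :: "(nat \<Rightarrow> nat) \<Rightarrow> 'a sequence" where
    f: "continuous_map euclidean sequence_topology f" "range f = G"
    using assms unfolding analytic_hypergraph_def analytic_in_def by blast
  let ?K = "{(x, y). fst (f y) \<noteq> 0 \<and> snd (f y) 0 = x \<and>
      (\<forall>i \<in> seq_dom (fst (f y)) - {0}. snd (f y) i \<in> closure S)}"
  have "open (- ?K)"
  proof (rule topological_space_class.openI)
    fix z assume z: "z \<in> - ?K"
    obtain x y where xy: "z = (x, y)" by (cases z)
    let ?n = "fst (f y)"
    consider "?n = 0" | "?n \<noteq> 0" "snd (f y) 0 \<noteq> x" |
        i where "i \<in> seq_dom ?n" "i \<noteq> 0" "snd (f y) i \<notin> closure S"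
      using z xy by auto
    then show "\<exists>T. open T \<and> z \<in> T \<and> T \<subseteq> - ?K"
    proof cases
      case 1
      then show ?thesis
        by (intro exI[of _ "UNIV \<times> {y'. fst (f y') = ?n}"] conjI open_Times open_length_preimage f(1))
           (auto simp: xy)
    next
      case 2
      then obtain U V where UV: "open U" "open V" "snd (f y) 0 \<in> U" "x \<in> V" "U \<inter> V = {}"
        using hausdorff[of "snd (f y) 0" x] by blast
      show ?thesis
        by (intro exI[of _ "V \<times> {y'. fst (f y') = ?n \<and> snd (f y') 0 \<in> U}"] conjI open_Times
              open_component_preimage f(1) zero_in_seq_dom UV 2(1))
           (use UV(3-5) in \<open>auto simp: xy\<close>)
    next
      case 3
      then show ?thesis
        by (intro exI[of _ "UNIV \<times> {y'. fst (f y') = ?n \<and> snd (f y') i \<in> - closure S}"] conjI open_Times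
              open_component_preimage f(1)) (auto simp: xy)
    qed
  qed
  moreover have "edge_starts G S = fst ` ?K"
  proof (intro equalityI subsetI)
    fix x assume "x \<in> edge_starts G S"
    then obtain n e where e: "(n, e) \<in> range f" "n \<noteq> 0" "e 0 = x" "\<forall>i \<in> seq_dom n - {0}. e i \<in> closure S"
      unfolding edge_starts_def f(2) by auto
    then obtain y where "f y = (n, e)" by (metis rangeE)
    then show "x \<in> fst ` ?K" using e by (intro image_eqI[of _ _ "(x, y)"]) auto
  next
    fix x assume "x \<in> fst ` ?K"
    then obtain y where "(x, y) \<in> ?K" by auto
    then show "x \<in> edge_starts G S"
      unfolding edge_starts_def f(2)[symmetric] by (intro CollectI bexI[of _ "f y"]) (auto split: prod.splits)
  qed
  ultimately show ?thesis unfolding suslin_def closed_def by blast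
qed

text \<open>
  A hypergraph containing the empty sequence has no anticliques at all, not even \<open>{}\<close>, and
  contributes nothing to the ideal.
\<close>

lemma hypergraph_ideal_eq_small:
  fixes \<G> :: "'a::polish_space sequence set set"
  assumes "countable \<G>" "\<forall>G \<in> \<G>. nearly_open G"
  obtains \<Phi> where "suslin_closure_family \<Phi>"
    "hypergraph_ideal \<G> = Collect (suslin_closure_family.small \<Phi>)"
proof -
  define \<H> where "\<H> = {G \<in> \<G>. (0, \<lambda>_. undefined) \<notin> G}"
  \<comment> \<open>With no hypergraph left, the ideal contains only the empty set. The constant
    value \<open>UNIV\<close> produces the same ideal, as only \<open>{}\<close> is disjoint from
    it.\<close>
  define \<Phi> where "\<Phi> k = (if \<H> = {} then (\<lambda>_. UNIV) else edge_starts (from_nat_into \<H> k))" for k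
  have H: "countable \<H>" "\<And>G. G \<in> \<H> \<Longrightarrow> nearly_open G"
    using assms by (auto simp: \<H>_def intro: countable_subset)
  interpret suslin_closure_family \<Phi>
  proof
    have "analytic_hypergraph G" if "G \<in> \<H>" for G
      using H(2)[OF that] unfolding nearly_open_def by (rule conjunct1)
    then show "suslin (\<Phi> k A)" for k A
      using from_nat_into[of \<H> k] by (simp add: \<Phi>_def suslin_closed suslin_edge_starts)
    show "\<Phi> k A \<subseteq> \<Phi> k B" if "A \<subseteq> B" for k A B
      by (simp add: \<Phi>_def edge_starts_mono[OF that])
    show "\<Phi> k (closure A) = \<Phi> k A" for k A
      by (simp add: \<Phi>_def edge_starts_closure)
  qed
  have eq: "(\<exists>G \<in> \<G>. anticlique G B) \<longleftrightarrow> (\<exists>G \<in> \<H>. B \<inter> edge_starts G B = {})" for B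
  proof -
    have "\<not> anticlique G B" if "(0, \<lambda>_. undefined) \<in> G" for G
      using that sequences_0[of "\<lambda>_. undefined" B] unfolding anticlique_def by blast
    then have "(\<exists>G \<in> \<G>. anticlique G B) \<longleftrightarrow> (\<exists>G \<in> \<H>. anticlique G B)"
      unfolding \<H>_def by blast
    also have "\<dots> \<longleftrightarrow> (\<exists>G \<in> \<H>. B \<inter> edge_starts G B = {})"
      by (rule bex_cong) (simp_all add: H(2) anticlique_iff \<H>_def)
    finally show ?thesis .
  qed
  have gen: "(\<exists>G \<in> \<G>. anticlique G B) \<longleftrightarrow> (\<exists>k. B \<inter> \<Phi> k B = {})" if "\<H> \<noteq> {}" for B
  proof -
    have "(\<exists>k. B \<inter> \<Phi> k B = {}) \<longleftrightarrow> (\<exists>G \<in> range (from_nat_into \<H>). B \<inter> edge_starts G B = {})"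
      using that by (simp add: \<Phi>_def)
    then show ?thesis unfolding eq range_from_nat_into[OF that H(1)] by simp
  qed
  have "A \<in> hypergraph_ideal \<G> \<longleftrightarrow> small A" for A
  proof (cases "\<H> = {}")
    case True
    have "(\<exists>G \<in> \<G>. anticlique G B) \<Longrightarrow> (\<exists>k. B \<inter> \<Phi> k B = {})" for B
      unfolding eq using True by simp
    moreover have "small A \<Longrightarrow> A = {}"
      unfolding small_def \<Phi>_def using True by auto
    moreover have "{} \<in> hypergraph_ideal \<G>"
      unfolding hypergraph_ideal_def by (auto intro: exI[of _ "{}"])
    moreover have "small A" if "A \<in> hypergraph_ideal \<G>"
      using that calculation(1) unfolding hypergraph_ideal_def small_def mem_Collect_eq by metis
    ultimately show ?thesis by metis
  next
    case False
    show ?thesis unfolding hypergraph_ideal_def small_def mem_Collect_eq gen[OF False] ..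
  qed
  then show thesis by (intro that[OF suslin_closure_family_axioms]) auto
qed

section \<open>A criterion for properness\<close>

definition Imp :: "fm \<Rightarrow> fm \<Rightarrow> fm" where "Imp \<phi> \<psi> = Neg (Conj \<phi> (Neg \<psi>))"
definition Disj :: "fm \<Rightarrow> fm \<Rightarrow> fm" where "Disj \<phi> \<psi> = Neg (Conj (Neg \<phi>) (Neg \<psi>))"
definition Iff :: "fm \<Rightarrow> fm \<Rightarrow> fm" where "Iff \<phi> \<psi> = Conj (Imp \<phi> \<psi>) (Imp \<psi> \<phi>)"
definition Exists :: "nat \<Rightarrow> fm \<Rightarrow> fm" where "Exists i \<phi> = Neg (All i (Neg \<phi>))"

lemma sat_derived [simp]:
  "sat H E (Imp \<phi> \<psi>) s \<longleftrightarrow> (sat H E \<phi> s \<longrightarrow> sat H E \<psi> s)"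
  "sat H E (Disj \<phi> \<psi>) s \<longleftrightarrow> (sat H E \<phi> s \<or> sat H E \<psi> s)"
  "sat H E (Iff \<phi> \<psi>) s \<longleftrightarrow> (sat H E \<phi> s \<longleftrightarrow> sat H E \<psi> s)"
  "sat H E (Exists i \<phi>) s \<longleftrightarrow> (\<exists>a \<in> H. sat H E \<phi> (s(i := a)))"
  by (auto simp: Imp_def Disj_def Iff_def Exists_def)

text \<open>Elementarity is used twice: downwards for the existential formula, then upwards for the
  witness found in \<open>M\<close>.\<close>

lemma elementary_submodel_witness:
  assumes "elementary_submodel M H E" "range s \<subseteq> M" "a \<in> H" "sat H E \<phi> (s(i := a))"
  obtains b where "b \<in> M" "sat H E \<phi> (s(i := b))"
proof -
  have "sat M E (Exists i \<phi>) s \<longleftrightarrow> sat H E (Exists i \<phi>) s"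
    using assms(1,2) unfolding elementary_submodel_def by blast
  then obtain b where b: "b \<in> M" "sat M E \<phi> (s(i := b))" using assms(3,4) by auto
  then have "range (s(i := b)) \<subseteq> M" using assms(2) by auto
  then have "sat H E \<phi> (s(i := b))"
    using b(2) assms(1) unfolding elementary_submodel_def by blast
  then show thesis using that b(1) by blast
qed

lemmas sat_unfold = sat.simps sat_derived fun_upd_apply if_True if_False simp_thms
  numeral_eq_iff num.inject num.distinct one_eq_numeral_iff numeral_eq_one_iff
  zero_neq_numeral numeral_neq_zero zero_neq_one one_neq_zero

definition kpair_in :: "'u set \<Rightarrow> 'u rel \<Rightarrow> 'u \<Rightarrow> 'u \<Rightarrow> 'u \<Rightarrow> bool" where
  "kpair_in H E x y z \<longleftrightarrow> (\<exists>a \<in> H. \<exists>b \<in> H. (\<forall>t \<in> H. (t, a) \<in> E \<longleftrightarrow> t = x) \<and>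
     (\<forall>t \<in> H. (t, b) \<in> E \<longleftrightarrow> t = x \<or> t = y) \<and> (\<forall>t \<in> H. (t, z) \<in> E \<longleftrightarrow> t = a \<or> t = b))"

text \<open>\<open>Suc (x + y + z)\<close> exceeds all three free variables, so the bound ones are
  fresh.\<close>

definition Kpair :: "nat \<Rightarrow> nat \<Rightarrow> nat \<Rightarrow> fm" where
  "Kpair x y z = (let a = Suc (x + y + z); b = Suc a; t = Suc b in
     Exists a (Exists b (Conj (All t (Iff (Mem t a) (Eq t x)))
       (Conj (All t (Iff (Mem t b) (Disj (Eq t x) (Eq t y))))
         (All t (Iff (Mem t z) (Disj (Eq t a) (Eq t b))))))))"

lemma sat_Kpair [simp]: "sat H E (Kpair x y z) s \<longleftrightarrow> kpair_in H E (s x) (s y) (s z)"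
  by (simp add: Kpair_def kpair_in_def Let_def)

text \<open>
  \<open>N\<close> is contained in the orbit of a point under a partial function belonging to \<open>H\<close>: this expresses
  the countability of \<open>N\<close> without reference to \<open>\<omega>\<close>. In the formulas below the variables 0, 1, 2, 3 stand
  for \<open>u\<close>, \<open>l\<close>, \<open>F\<close>, \<open>N\<close>.
\<close>

definition orbit_in :: "'u set \<Rightarrow> 'u rel \<Rightarrow> 'u \<Rightarrow> bool" where
  "orbit_in H E N \<longleftrightarrow> (\<exists>R \<in> H. \<exists>x \<in> H.
     (\<forall>a \<in> H. \<forall>b \<in> H. \<forall>b' \<in> H. \<forall>z \<in> H. \<forall>z' \<in> H.
        (z, R) \<in> E \<and> (z', R) \<in> E \<and> kpair_in H E a b z \<and> kpair_in H E a b' z' \<longrightarrow> b = b') \<and>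
     (\<forall>S \<in> H. (x, S) \<in> E \<and>
        (\<forall>a \<in> H. \<forall>b \<in> H. \<forall>z \<in> H. (z, R) \<in> E \<and> (a, S) \<in> E \<and> kpair_in H E a b z \<longrightarrow> (b, S) \<in> E) \<longrightarrow>
        (\<forall>a \<in> H. (a, N) \<in> E \<longrightarrow> (a, S) \<in> E)))"

definition Orbit :: fm where
  "Orbit = Exists 4 (Exists 5 (Conj
     (All 6 (All 7 (All 8 (All 9 (All 10 (Imp
        (Conj (Mem 9 4) (Conj (Mem 10 4) (Conj (Kpair 6 7 9) (Kpair 6 8 10)))) (Eq 7 8)))))))
     (All 11 (Imp
        (Conj (Mem 5 11) (All 6 (All 7 (All 9 (Imp (Conj (Mem 9 4) (Conj (Mem 6 11) (Kpair 6 7 9))) (Mem 7 11))))))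
        (All 6 (Imp (Mem 6 3) (Mem 6 11)))))))"

lemma sat_Orbit: "sat H E Orbit s \<longleftrightarrow> orbit_in H E (s 3)"
  by (simp only: Orbit_def orbit_in_def sat_unfold sat_Kpair)

text \<open>\<open>F\<close> is treated as a relation: wherever it has a value at a member of
  \<open>N\<close>, some value must be in \<open>N\<close>. Closure under pairs lets
  \<open>N\<close> form the arguments of \<open>F\<close>.\<close>

definition closed_in :: "'u set \<Rightarrow> 'u rel \<Rightarrow> 'u \<Rightarrow> 'u \<Rightarrow> 'u \<Rightarrow> bool" where
  "closed_in H E u F N \<longleftrightarrow> (u, N) \<in> E \<and>
     (\<forall>a \<in> H. \<forall>b \<in> H. (a, N) \<in> E \<and> (b, N) \<in> E \<longrightarrow> (\<exists>z \<in> H. (z, N) \<in> E \<and> kpair_in H E a b z)) \<and>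
     (\<forall>a \<in> H. (a, N) \<in> E \<and> (\<exists>b \<in> H. \<exists>z \<in> H. (z, F) \<in> E \<and> kpair_in H E a b z) \<longrightarrow>
        (\<exists>b \<in> H. \<exists>z \<in> H. (b, N) \<in> E \<and> (z, F) \<in> E \<and> kpair_in H E a b z))"

definition Closed :: fm where
  "Closed = Conj (Mem 0 3) (Conj
     (All 4 (All 5 (Imp (Conj (Mem 4 3) (Mem 5 3)) (Exists 6 (Conj (Mem 6 3) (Kpair 4 5 6))))))
     (All 4 (Imp (Conj (Mem 4 3) (Exists 5 (Exists 6 (Conj (Mem 6 2) (Kpair 4 5 6)))))
        (Exists 5 (Exists 6 (Conj (Mem 5 3) (Conj (Mem 6 2) (Kpair 4 5 6))))))))"

lemma sat_Closed: "sat H E Closed s \<longleftrightarrow> closed_in H E (s 0) (s 2) (s 3)"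
  by (simp only: Closed_def closed_in_def sat_unfold sat_Kpair)

definition le_in :: "'u set \<Rightarrow> 'u rel \<Rightarrow> 'u \<Rightarrow> 'u \<Rightarrow> 'u \<Rightarrow> bool" where
  "le_in H E l x y \<longleftrightarrow> (\<exists>z \<in> H. (z, l) \<in> E \<and> kpair_in H E x y z)"

definition Le :: "nat \<Rightarrow> nat \<Rightarrow> fm" where
  "Le x y = Exists (Suc (Suc (x + y))) (Conj (Mem (Suc (Suc (x + y))) 1) (Kpair x y (Suc (Suc (x + y)))))"

lemma sat_Le [simp]: "sat H E (Le x y) s \<longleftrightarrow> le_in H E (s 1) (s x) (s y)"
  by (simp add: Le_def le_in_def)

definition generic_in :: "'u set \<Rightarrow> 'u rel \<Rightarrow> 'u \<Rightarrow> 'u \<Rightarrow> 'u \<Rightarrow> bool" where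
  "generic_in H E u l N \<longleftrightarrow> (\<forall>p \<in> H. (p, N) \<in> E \<and> (p, u) \<in> E \<longrightarrow>
     (\<exists>q \<in> H. (q, u) \<in> E \<and> le_in H E l q p \<and>
       (\<forall>D \<in> H. (D, N) \<in> E \<and> (\<forall>a \<in> H. (a, D) \<in> E \<longrightarrow> (a, u) \<in> E) \<and>
            (\<forall>a \<in> H. (a, u) \<in> E \<longrightarrow> (\<exists>b \<in> H. (b, D) \<in> E \<and> le_in H E l b a)) \<longrightarrow>
          (\<forall>r \<in> H. (r, u) \<in> E \<and> le_in H E l r q \<longrightarrow>
             (\<exists>d \<in> H. \<exists>t \<in> H. (d, D) \<in> E \<and> (d, N) \<in> E \<and> (t, u) \<in> E \<and>
                le_in H E l t d \<and> le_in H E l t r)))))"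

definition Generic :: fm where
  "Generic = (let
     predense = All 7 (Imp (Conj (Mem 7 0) (Le 7 5))
       (Exists 8 (Exists 9 (Conj (Mem 8 6) (Conj (Mem 8 3) (Conj (Mem 9 0) (Conj (Le 9 8) (Le 9 7))))))));
     dense = Conj (All 7 (Imp (Mem 7 6) (Mem 7 0)))
       (All 7 (Imp (Mem 7 0) (Exists 8 (Conj (Mem 8 6) (Le 8 7)))))
     in All 4 (Imp (Conj (Mem 4 3) (Mem 4 0)) (Exists 5 (Conj (Mem 5 0) (Conj (Le 5 4)
       (All 6 (Imp (Conj (Mem 6 3) dense) predense)))))))"

lemma sat_Generic: "sat H E Generic s \<longleftrightarrow> generic_in H E (s 0) (s 1) (s 3)"
  by (simp only: Generic_def generic_in_def sat_unfold sat_Le Let_def)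

text \<open>Being first order in the parameters \<open>u\<close> and \<open>l\<close>, this property
  lets elementarity replace an outside \<open>F\<close> by one belonging to the submodel.\<close>

definition guides_in :: "'u set \<Rightarrow> 'u rel \<Rightarrow> 'u \<Rightarrow> 'u \<Rightarrow> 'u \<Rightarrow> bool" where
  "guides_in H E u l F \<longleftrightarrow>
     (\<forall>N \<in> H. closed_in H E u F N \<and> orbit_in H E N \<longrightarrow> generic_in H E u l N)"

lemma sat_guides: "sat H E (All 3 (Imp (Conj Closed Orbit) Generic)) s \<longleftrightarrow> guides_in H E (s 0) (s 1) (s 2)"
  by (simp only: guides_in_def sat_unfold sat_Closed sat_Orbit sat_Generic)

section \<open>Pairs, numerals and countability inside the structure\<close>

locale hereditary =
  fixes \<theta> :: "'u rel" and H :: "'u set" and E :: "'u rel"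
  assumes hereditary: "hereditary_structure \<theta> H E"
begin

lemma wf_E: "wf E" and inj_elts: "inj_on (elts E) H" and Card_order: "Card_order \<theta>"
  and natLeq_less: "natLeq <o \<theta>" and E_Times: "E \<subseteq> H \<times> H"
  using hereditary by (simp_all only: hereditary_structure_def)

lemma E_subset: "(x, y) \<in> E \<Longrightarrow> x \<in> H" "(x, y) \<in> E \<Longrightarrow> y \<in> H"
  using E_Times by auto

lemma ex_elts:
  assumes "A \<subseteq> H" "|A| <o \<theta>"
  shows "\<exists>x \<in> H. elts E x = A"
proof -
  have "\<forall>A. A \<subseteq> H \<and> |A| <o \<theta> \<longleftrightarrow> (\<exists>x \<in> H. elts E x = A)"
    using hereditary unfolding hereditary_structure_def by (elim conjE)
  then show ?thesis using conjI[OF assms] by (metis (no_types, lifting))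
qed

lemma ex_elts_countable:
  assumes "A \<subseteq> H" "countable A"
  shows "\<exists>x \<in> H. elts E x = A"
  using assms natLeq_less by (intro ex_elts) (metis countable_card_le_natLeq ordLeq_ordLess_trans)+

text \<open>Having an element forces membership in \<open>H\<close>, where extensionality holds;
  points of the type outside \<open>H\<close> all have no elements.\<close>

lemma elts_eqD: "elts E x = elts E y \<Longrightarrow> elts E x \<noteq> {} \<Longrightarrow> x = y"
proof -
  assume eq: "elts E x = elts E y" and "elts E x \<noteq> {}"
  then obtain t where "(t, x) \<in> E" by (auto simp: elts_def)
  moreover from this have "(t, y) \<in> E" using eq by (auto simp: elts_def)
  ultimately have "x \<in> H" "y \<in> H" using E_subset(2) by blast+
  with eq show "x = y" using inj_onD[OF inj_elts] by blast
qed

lemma mem_iff_elts: "(x, y) \<in> E \<longleftrightarrow> x \<in> elts E y"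
  by (simp add: elts_def)

lemma kpair_in_iff:
  assumes "x \<in> H" "y \<in> H"
  shows "kpair_in H E x y z \<longleftrightarrow> is_kpair E x y z"
proof -
  have pair: "(\<forall>t \<in> H. (t, a) \<in> E \<longleftrightarrow> t = v \<or> t = w) \<longleftrightarrow> elts E a = {v, w}"
    if "v \<in> H" "w \<in> H" for a v w
    using that E_subset unfolding elts_def by blast
  have single: "(\<forall>t \<in> H. (t, a) \<in> E \<longleftrightarrow> t = x) \<longleftrightarrow> elts E a = {x}" for a
    using pair[OF assms(1,1), of a] by simp
  show ?thesis
  proof
    assume "kpair_in H E x y z"
    then obtain a b where ab: "a \<in> H" "b \<in> H" "elts E a = {x}" "elts E b = {x, y}"
        "\<forall>t \<in> H. (t, z) \<in> E \<longleftrightarrow> t = a \<or> t = b"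
      unfolding kpair_in_def single pair[OF assms] by (elim bexE conjE)
    then show "is_kpair E x y z"
      unfolding is_kpair_def pair[OF ab(1,2)] by (intro exI[of _ a] exI[of _ b] conjI)
  next
    assume "is_kpair E x y z"
    then obtain a b where ab: "elts E a = {x}" "elts E b = {x, y}" "elts E z = {a, b}"
      unfolding is_kpair_def by (elim exE conjE)
    then have "(a, z) \<in> E" "(b, z) \<in> E" by (auto simp: elts_def)
    then have "a \<in> H" "b \<in> H" by (simp_all add: E_subset(1))
    with ab show "kpair_in H E x y z"
      unfolding kpair_in_def single pair[OF assms] by (intro bexI[of _ a] bexI[of _ b] conjI) (simp_all add: pair)
  qed
qed

lemma is_kpair_inject:
  assumes "is_kpair E x y z" "is_kpair E x' y' z"
  shows "x = x' \<and> y = y'"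
proof -
  obtain a b a' b' where "elts E a = {x}" "elts E b = {x, y}" "elts E a' = {x'}" "elts E b' = {x', y'}"
      "{a, b} = {a', b'}"
    using assms unfolding is_kpair_def by metis
  then show ?thesis by (metis doubleton_eq_iff singleton_insert_inj_eq)
qed

lemma is_kpair_unique:
  assumes "is_kpair E x y z" "is_kpair E x y z'"
  shows "z = z'"
proof -
  obtain a b where ab: "elts E a = {x}" "elts E b = {x, y}" "elts E z = {a, b}"
    using assms(1) unfolding is_kpair_def by (elim exE conjE)
  obtain a' b' where ab': "elts E a' = {x}" "elts E b' = {x, y}" "elts E z' = {a', b'}"
    using assms(2) unfolding is_kpair_def by (elim exE conjE)
  have "a = a'" "b = b'" using ab ab' by (auto intro!: elts_eqD)
  then show ?thesis using ab ab' by (intro elts_eqD) auto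
qed

lemma ex_kpair:
  assumes "x \<in> H" "y \<in> H"
  shows "\<exists>z \<in> H. is_kpair E x y z"
proof -
  obtain a b where "a \<in> H" "elts E a = {x}" "b \<in> H" "elts E b = {x, y}"
    using ex_elts_countable[of "{x}"] ex_elts_countable[of "{x, y}"] assms by auto
  moreover from this obtain z where "z \<in> H" "elts E z = {a, b}"
    using ex_elts_countable[of "{a, b}"] by auto
  ultimately show ?thesis unfolding is_kpair_def by blast
qed

definition kpair :: "'u \<Rightarrow> 'u \<Rightarrow> 'u" where
  "kpair x y = (SOME z. z \<in> H \<and> is_kpair E x y z)"

lemma kpair:
  assumes "x \<in> H" "y \<in> H"
  shows "kpair x y \<in> H" "is_kpair E x y (kpair x y)"
proof -
  have "kpair x y \<in> H \<and> is_kpair E x y (kpair x y)"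
    unfolding kpair_def by (rule someI_ex) (use ex_kpair[OF assms] in \<open>simp add: Bex_def\<close>)
  then show "kpair x y \<in> H" "is_kpair E x y (kpair x y)" by simp_all
qed

lemma is_kpair_iff: "x \<in> H \<Longrightarrow> y \<in> H \<Longrightarrow> is_kpair E x y z \<longleftrightarrow> z = kpair x y"
  using kpair(2)[of x y] is_kpair_unique[of x y z "kpair x y"] by blast

lemma kpair_inject:
  "x \<in> H \<Longrightarrow> y \<in> H \<Longrightarrow> x' \<in> H \<Longrightarrow> y' \<in> H \<Longrightarrow> kpair x y = kpair x' y' \<longleftrightarrow> x = x' \<and> y = y'"
  using kpair(2)[of x y] kpair(2)[of x' y'] is_kpair_inject[of x y "kpair x y" x' y'] by auto

text \<open>Stand-ins for natural numbers that belong to every set containing \<open>u\<close> and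
  closed under pairing. Well-foundedness makes them distinct.\<close>

primrec numeral_code :: "'u \<Rightarrow> nat \<Rightarrow> 'u" where
  "numeral_code u 0 = u"
| "numeral_code u (Suc n) = kpair (numeral_code u n) (numeral_code u n)"

lemma numeral_code_in: "u \<in> H \<Longrightarrow> numeral_code u n \<in> H"
  by (induction n) (simp_all add: kpair)

lemma numeral_code_less:
  assumes "u \<in> H" "m < n"
  shows "(numeral_code u m, numeral_code u n) \<in> E\<^sup>+"
  using assms(2)
proof (induction n)
  case (Suc n)
  let ?x = "numeral_code u n"
  obtain a where "(?x, a) \<in> E" "(a, numeral_code u (Suc n)) \<in> E"
    using kpair(2)[OF numeral_code_in numeral_code_in, OF assms(1) assms(1), of n n]
    unfolding is_kpair_def elts_def by auto
  then have "(?x, numeral_code u (Suc n)) \<in> E\<^sup>+" by (rule trancl_into_trancl[OF r_into_trancl])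
  then show ?case using Suc by (metis less_SucE trancl_trans)
qed simp

lemma inj_numeral_code: "u \<in> H \<Longrightarrow> inj (numeral_code u)"
proof (rule linorder_injI)
  fix m n :: nat assume "u \<in> H" "m < n"
  then have "(numeral_code u m, numeral_code u n) \<in> E\<^sup>+" by (rule numeral_code_less)
  then show "numeral_code u m \<noteq> numeral_code u n" using wf_not_refl[OF wf_trancl[OF wf_E]] by metis
qed

text \<open>The orbit is countable and so is itself a set of the structure. Single-valuedness of
  \<open>R\<close> makes it closed, hence it contains \<open>N\<close>.\<close>

lemma orbit_in_countable:
  assumes "orbit_in H E N"
  shows "countable (elts E N)"
proof -
  obtain R x where R: "R \<in> H" "x \<in> H"
    and fn: "\<forall>a \<in> H. \<forall>b \<in> H. \<forall>b' \<in> H. \<forall>z \<in> H. \<forall>z' \<in> H.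
      (z, R) \<in> E \<and> (z', R) \<in> E \<and> kpair_in H E a b z \<and> kpair_in H E a b' z' \<longrightarrow> b = b'"
    and least: "\<forall>S \<in> H. (x, S) \<in> E \<and>
      (\<forall>a \<in> H. \<forall>b \<in> H. \<forall>z \<in> H. (z, R) \<in> E \<and> (a, S) \<in> E \<and> kpair_in H E a b z \<longrightarrow> (b, S) \<in> E) \<longrightarrow>
      (\<forall>a \<in> H. (a, N) \<in> E \<longrightarrow> (a, S) \<in> E)"
    using assms unfolding orbit_in_def by (elim bexE conjE)
  define succ_in where "succ_in a b \<longleftrightarrow> b \<in> H \<and> (\<exists>z \<in> H. (z, R) \<in> E \<and> kpair_in H E a b z)" for a b
  \<comment> \<open>Where the partial function stops, restarting at \<open>x\<close> keeps the
    iteration total and inside the orbit.\<close>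
  define h where "h a = (if \<exists>b. succ_in a b then SOME b. succ_in a b else x)" for a
  have h: "succ_in a (h a)" if "succ_in a b" for a b
    using that someI[of "succ_in a" b] by (auto simp: h_def)
  define g where "g n = (h ^^ n) x" for n
  have g: "g 0 = x" "g (Suc n) = h (g n)" for n by (simp_all add: g_def)
  have h_in: "h a \<in> H" for a
  proof (cases "\<exists>b. succ_in a b")
    case True
    then show ?thesis using h by (auto simp: succ_in_def)
  next
    case False
    then show ?thesis using R(2) by (simp add: h_def)
  qed
  have "range g \<subseteq> H"
  proof
    fix a assume "a \<in> range g"
    then obtain n where "a = g n" ..
    then show "a \<in> H" using R(2) h_in by (cases n) (simp_all add: g)
  qed
  then have "\<exists>S \<in> H. elts E S = range g" by (rule ex_elts_countable) simp
  then obtain S where S: "S \<in> H" "elts E S = range g" ..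
  have "\<forall>a \<in> H. (a, N) \<in> E \<longrightarrow> (a, S) \<in> E"
  proof (rule bspec[OF least S(1), THEN mp], intro conjI ballI impI)
    show "(x, S) \<in> E" using g(1) S(2) by (metis mem_iff_elts rangeI)
    fix a b z assume z: "a \<in> H" "b \<in> H" "z \<in> H" "(z, R) \<in> E \<and> (a, S) \<in> E \<and> kpair_in H E a b z"
    then obtain n where n: "a = g n" using S(2) by (auto simp: mem_iff_elts)
    have "succ_in (g n) b" using z n unfolding succ_in_def by blast
    then have "succ_in (g n) (g (Suc n))" unfolding g(2) by (rule h)
    then obtain z' where "g (Suc n) \<in> H" "z' \<in> H" "(z', R) \<in> E" "kpair_in H E a (g (Suc n)) z'"
      unfolding succ_in_def n by (elim conjE bexE)
    then have "g (Suc n) = b" using z fn by metis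
    then show "(b, S) \<in> E" using S(2) by (metis mem_iff_elts rangeI)
  qed
  then have "elts E N \<subseteq> range g" using E_subset(1) by (auto simp: S(2)[symmetric] elts_def)
  then show ?thesis by (rule countable_subset) simp
qed

text \<open>Infinitude gives an injective enumeration by \<open>nat\<close>, for which passing to
  the next element is a single-valued relation.\<close>

lemma countable_orbit_in:
  assumes "countable (elts E N)" "infinite (elts E N)"
  shows "orbit_in H E N"
proof -
  define e where "e = from_nat_into (elts E N)"
  have e: "bij_betw e UNIV (elts E N)" unfolding e_def using assms by (rule bij_betw_from_nat_into)
  have "(e n, N) \<in> E" for n using bij_betwE[OF e] by (simp add: mem_iff_elts)
  then have e_in: "e n \<in> H" for n by (rule E_subset(1))
  have e_inj: "e m = e n \<longleftrightarrow> m = n" for m n using bij_betw_imp_inj_on[OF e] by (simp add: inj_eq)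
  have "range (\<lambda>n. kpair (e n) (e (Suc n))) \<subseteq> H" by (intro image_subsetI kpair(1) e_in)
  then have "\<exists>R \<in> H. elts E R = range (\<lambda>n. kpair (e n) (e (Suc n)))"
    by (rule ex_elts_countable) simp
  then obtain R where R: "R \<in> H" "elts E R = range (\<lambda>n. kpair (e n) (e (Suc n)))" ..
  have R_mem: "(kpair (e n) (e (Suc n)), R) \<in> E" for n
    unfolding mem_iff_elts R(2) by (rule rangeI)
  have R_only: "\<exists>n. a = e n \<and> b = e (Suc n)"
    if z: "a \<in> H" "b \<in> H" "(z, R) \<in> E" "kpair_in H E a b z" for a b z
  proof -
    have "z = kpair a b" using z(4) kpair_in_iff[OF z(1,2)] is_kpair_iff[OF z(1,2)] by simp
    moreover obtain n where "z = kpair (e n) (e (Suc n))"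
      using z(3) unfolding mem_iff_elts R(2) by (rule rangeE)
    ultimately show ?thesis using kpair_inject[OF z(1,2) e_in e_in] by metis
  qed
  show ?thesis unfolding orbit_in_def
  proof (rule bexI[of _ R], rule bexI[of _ "e 0"], intro conjI ballI impI)
    fix a b b' z z' assume "a \<in> H" "b \<in> H" "b' \<in> H"
      "(z, R) \<in> E \<and> (z', R) \<in> E \<and> kpair_in H E a b z \<and> kpair_in H E a b' z'"
    then show "b = b'" using R_only[of a b z] R_only[of a b' z'] e_inj by metis
  next
    fix S a assume S: "S \<in> H" "(e 0, S) \<in> E \<and>
      (\<forall>a\<in>H. \<forall>b\<in>H. \<forall>z\<in>H. (z, R) \<in> E \<and> (a, S) \<in> E \<and> kpair_in H E a b z \<longrightarrow> (b, S) \<in> E)"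
    assume a: "a \<in> H" "(a, N) \<in> E"
    have "(e n, S) \<in> E" for n
    proof (induction n)
      case (Suc n)
      have "kpair_in H E (e n) (e (Suc n)) (kpair (e n) (e (Suc n)))"
        using kpair_in_iff kpair(2) e_in by blast
      then show ?case using S(2) Suc e_in kpair(1) R_mem by blast
    qed (use S in simp)
    moreover obtain n where "a = e n" using a(2) bij_betw_imp_surj_on[OF e] unfolding mem_iff_elts by auto
    ultimately show "(a, S) \<in> E" by blast
  qed (use R e_in in auto)
qed

end

section \<open>Coding the poset and the guiding relation\<close>

locale coded_poset = hereditary \<theta> H E
  for \<theta> :: "'u rel" and H :: "'u set" and E :: "'u rel" +
  fixes P :: "'p set" and le :: "'p \<Rightarrow> 'p \<Rightarrow> bool" and c :: "'p \<Rightarrow> 'u" and u l :: 'u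
  assumes codes: "codes_poset H E P le c u l" and card_Pow: "|Pow P| <o \<theta>"
    and le_refl: "p \<in> P \<Longrightarrow> le p p"
begin

lemma u_in: "u \<in> H" and l_in: "l \<in> H" and inj_c: "inj_on c P" and elts_u: "elts E u = c ` P"
  and elts_l: "elts E l = {z \<in> H. \<exists>p \<in> P. \<exists>q \<in> P. le p q \<and> is_kpair E (c p) (c q) z}"
  using codes by (simp_all only: codes_poset_def)

lemma mem_u: "(x, u) \<in> E \<longleftrightarrow> x \<in> c ` P"
  using elts_u by (auto simp: elts_def)

lemma c_in: "p \<in> P \<Longrightarrow> c p \<in> H"
  using E_subset(1)[of "c p" u] mem_u by simp

lemma c_eq_iff: "p \<in> P \<Longrightarrow> q \<in> P \<Longrightarrow> c p = c q \<longleftrightarrow> p = q"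
  using inj_on_eq_iff[OF inj_c] by blast

lemma le_in_iff:
  assumes "p \<in> P" "q \<in> P"
  shows "le_in H E l (c p) (c q) \<longleftrightarrow> le p q"
proof
  assume "le_in H E l (c p) (c q)"
  then obtain z where z: "(z, l) \<in> E" "is_kpair E (c p) (c q) z"
    unfolding le_in_def kpair_in_iff[OF c_in[OF assms(1)] c_in[OF assms(2)]] by (elim bexE conjE)
  from z(1) obtain p' q' where "p' \<in> P" "q' \<in> P" "le p' q'" "is_kpair E (c p') (c q') z"
    unfolding mem_iff_elts elts_l by blast
  then show "le p q" using is_kpair_inject[OF z(2)] c_eq_iff assms by metis
next
  assume "le p q"
  let ?z = "kpair (c p) (c q)"
  note z = kpair[OF c_in[OF assms(1)] c_in[OF assms(2)]]
  have "(?z, l) \<in> E" unfolding mem_iff_elts elts_l using \<open>le p q\<close> assms z by blast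
  then show "le_in H E l (c p) (c q)"
    unfolding le_in_def kpair_in_iff[OF c_in[OF assms(1)] c_in[OF assms(2)]] using z by blast
qed

definition set_code :: "'p set \<Rightarrow> 'u" where
  "set_code D = (SOME x. x \<in> H \<and> elts E x = c ` D)"

lemma set_code:
  assumes "D \<subseteq> P"
  shows "set_code D \<in> H \<and> elts E (set_code D) = c ` D"
proof -
  have "|c ` D| \<le>o |D|" by (rule card_of_image)
  also have "|D| \<le>o |P|" using assms by (rule card_of_mono1)
  finally have "|c ` D| <o |Pow P|" using card_of_Pow by (rule ordLeq_ordLess_trans)
  then have "|c ` D| <o \<theta>" using card_Pow by (rule ordLess_transitive)
  moreover have "c ` D \<subseteq> H" using assms c_in by blast
  ultimately have "\<exists>x \<in> H. elts E x = c ` D" by (intro ex_elts)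
  then show ?thesis unfolding set_code_def Bex_def by (rule someI_ex)
qed

lemma set_code_unique: "D \<subseteq> P \<Longrightarrow> x \<in> H \<Longrightarrow> elts E x = c ` D \<Longrightarrow> set_code D = x"
  using set_code[of D] inj_onD[OF inj_elts] by metis

lemma set_code_inject:
  assumes "C \<subseteq> P" "D \<subseteq> P" "set_code C = set_code D"
  shows "C = D"
proof -
  have "c ` C = c ` D" using set_code[OF assms(1)] set_code[OF assms(2)] assms(3) by simp
  then show ?thesis using inj_on_image_eq_iff[OF inj_c assms(1,2)] by blast
qed

text \<open>All arguments of a step are packed into one member of \<open>H\<close>, so that the
  guide becomes a binary relation.\<close>

definition tuple :: "'i::countable \<Rightarrow> 'p \<Rightarrow> 'p \<Rightarrow> 'p set \<Rightarrow> 'u" where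
  "tuple i p q D = kpair (kpair (numeral_code u (to_nat i)) (c p)) (kpair (c q) (set_code D))"

lemma tuple_in: "p \<in> P \<Longrightarrow> q \<in> P \<Longrightarrow> D \<subseteq> P \<Longrightarrow> tuple i p q D \<in> H"
  by (simp add: tuple_def kpair numeral_code_in u_in c_in set_code)

lemma tuple_inject:
  assumes "p \<in> P" "q \<in> P" "D \<subseteq> P" "p' \<in> P" "q' \<in> P" "D' \<subseteq> P" "tuple i p q D = tuple i' p' q' D'"
  shows "i = i' \<and> p = p' \<and> q = q' \<and> D = D'"
proof -
  have "numeral_code u (to_nat i) = numeral_code u (to_nat i')" "c p = c p'" "c q = c q'"
      "set_code D = set_code D'"
    using assms(7) by (simp_all add: tuple_def kpair_inject kpair numeral_code_in u_in c_in set_code assms(1-6))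
  then show ?thesis
    using assms(1-6) inj_eq[OF inj_numeral_code[OF u_in]] c_eq_iff set_code_inject by simp
qed

lemma ex_guide:
  fixes step :: "'i::countable \<Rightarrow> 'p \<Rightarrow> 'p \<Rightarrow> 'p set \<Rightarrow> 'p \<Rightarrow> bool"
  shows "\<exists>F \<in> H. elts E F = {kpair (tuple i p q D) (c r) |i p q D r.
    p \<in> P \<and> q \<in> P \<and> D \<subseteq> P \<and> r \<in> P \<and> step i p q D r}" (is "\<exists>F \<in> H. elts E F = ?G")
proof (rule ex_elts)
  show "?G \<subseteq> H" by (auto intro!: kpair tuple_in c_in)
  \<comment> \<open>The dense sets among the arguments bring in \<open>Pow P\<close>; the summand
    \<open>nat\<close> makes the bound infinite even for a finite poset and accommodates the
    countable index type.\<close>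
  obtain \<kappa> :: "('p set + nat) rel" where \<kappa>: "Card_order \<kappa>" "\<not> finite (Field \<kappa>)" "\<kappa> <o \<theta>" "natLeq \<le>o \<kappa>" "|Pow P| \<le>o \<kappa>"
  proof (rule that[of "|Pow P <+> (UNIV :: nat set)|"])
    let ?\<kappa> = "|Pow P <+> (UNIV :: nat set)|"
    show "Card_order ?\<kappa>" by (rule card_of_Card_order)
    show "\<not> finite (Field ?\<kappa>)" by (simp add: Field_card_of)
    show "|Pow P| \<le>o ?\<kappa>" by (rule card_of_Plus1)
    show nat: "natLeq \<le>o ?\<kappa>"
      using card_of_Plus2[of "UNIV :: nat set" "Pow P"] card_of_nat ordIso_ordLeq_trans ordIso_symmetric by blast
    have UNIV_less: "|UNIV :: nat set| <o \<theta>" using card_of_nat natLeq_less by (rule ordIso_ordLess_trans)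
    have "|UNIV :: nat set| \<le>o |Field \<theta>|"
      using ordLess_imp_ordLeq[OF UNIV_less] ordIso_symmetric[OF card_of_Field_ordIso[OF Card_order]]
      by (rule ordLeq_ordIso_trans)
    then have "\<not> finite (Field \<theta>)" using card_of_ordLeq_finite infinite_UNIV_nat by blast
    then show "?\<kappa> <o \<theta>" using Card_order card_Pow UNIV_less by (rule card_of_Plus_ordLess_infinite_Field)
  qed
  have P: "|P| \<le>o \<kappa>"
    using ordLess_imp_ordLeq[OF card_of_Pow[of P]] \<kappa>(5) by (rule ordLeq_transitive)
  have I: "|UNIV :: 'i set| \<le>o \<kappa>"
    using countableI_type[of "UNIV :: 'i set"] \<kappa>(4) unfolding countable_card_le_natLeq by (rule ordLeq_transitive)
  let ?T = "(UNIV :: 'i set) \<times> P \<times> P \<times> Pow P \<times> P"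
  have "?G \<subseteq> (\<lambda>(i, p, q, D, r). kpair (tuple i p q D) (c r)) ` ?T"
  proof
    fix x assume "x \<in> ?G"
    then obtain i p q D r where "x = kpair (tuple i p q D) (c r)" "(i, p, q, D, r) \<in> ?T"
      by blast
    then show "x \<in> (\<lambda>(i, p, q, D, r). kpair (tuple i p q D) (c r)) ` ?T"
      by (intro image_eqI[of _ _ "(i, p, q, D, r)"]) simp_all
  qed
  then have "|?G| \<le>o |?T|" by (rule ordLeq_transitive[OF card_of_mono1 card_of_image])
  also have "|?T| \<le>o \<kappa>"
    using \<kappa>(1,2,5) P I by (intro card_of_Times_ordLeq_infinite_Field)
  finally show "|?G| <o \<theta>" using \<kappa>(3) by (rule ordLeq_ordLess_trans)
qed

end

context coded_poset
begin

section \<open>Genericity of guided submodels\<close>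

lemma dense_subset: "dense_in_poset P le D \<Longrightarrow> D \<subseteq> P"
  by (simp add: dense_in_poset_def)

lemma guides_in:
  fixes step :: "'i::countable \<Rightarrow> 'p \<Rightarrow> 'p \<Rightarrow> 'p set \<Rightarrow> 'p \<Rightarrow> bool"
  assumes F: "elts E F = {kpair (tuple i p q D) (c r) |i p q D r.
      p \<in> P \<and> q \<in> P \<and> D \<subseteq> P \<and> r \<in> P \<and> step i p q D r}"
    and total: "\<And>i p q D. p \<in> P \<Longrightarrow> q \<in> P \<Longrightarrow> dense_in_poset P le D \<Longrightarrow> \<exists>r \<in> P. step i p q D r"
    and generic: "\<And>Q \<D> p. countable Q \<Longrightarrow> Q \<subseteq> P \<Longrightarrow> countable \<D> \<Longrightarrow> \<D> \<noteq> {} \<Longrightarrow>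
      (\<And>D. D \<in> \<D> \<Longrightarrow> dense_in_poset P le D) \<Longrightarrow>
      (\<And>i p q D. p \<in> Q \<Longrightarrow> q \<in> Q \<Longrightarrow> D \<in> \<D> \<Longrightarrow> \<exists>r \<in> Q. step i p q D r) \<Longrightarrow> p \<in> Q \<Longrightarrow>
      \<exists>q \<in> P. le q p \<and> (\<forall>D \<in> \<D>. predense_below P le q (D \<inter> Q))"
  shows "guides_in H E u l F"
  unfolding guides_in_def
proof (intro ballI impI)
  fix N assume N: "N \<in> H" "closed_in H E u F N \<and> orbit_in H E N"
  then obtain u_N: "(u, N) \<in> E"
    and pair_N: "\<forall>a \<in> H. \<forall>b \<in> H. (a, N) \<in> E \<and> (b, N) \<in> E \<longrightarrow> (\<exists>z \<in> H. (z, N) \<in> E \<and> kpair_in H E a b z)"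
    and F_N: "\<forall>a \<in> H. (a, N) \<in> E \<and> (\<exists>b \<in> H. \<exists>z \<in> H. (z, F) \<in> E \<and> kpair_in H E a b z) \<longrightarrow>
        (\<exists>b \<in> H. \<exists>z \<in> H. (b, N) \<in> E \<and> (z, F) \<in> E \<and> kpair_in H E a b z)"
    unfolding closed_in_def by (elim conjE)
  have count: "countable (elts E N)" using N(2) orbit_in_countable by blast
  define Q where "Q = {p \<in> P. (c p, N) \<in> E}"
  define \<D> where "\<D> = {D. dense_in_poset P le D \<and> (set_code D, N) \<in> E}"
  have kpair_N: "(kpair a b, N) \<in> E" if ab: "(a, N) \<in> E" "(b, N) \<in> E" for a b
  proof -
    have H: "a \<in> H" "b \<in> H" using ab by (simp_all add: E_subset(1))
    then obtain z where "(z, N) \<in> E" "kpair_in H E a b z" using pair_N ab by meson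
    then show ?thesis using kpair_in_iff[OF H] is_kpair_iff[OF H] by simp
  qed
  have numeral_N: "(numeral_code u n, N) \<in> E" for n
    by (induction n) (simp_all add: u_N kpair_N)
  have "Q \<subseteq> P" by (auto simp: Q_def)
  have "countable Q"
  proof (rule countable_image_inj_on)
    show "countable (c ` Q)" by (rule countable_subset[OF _ count]) (auto simp: Q_def elts_def)
    show "inj_on c Q" using inj_c \<open>Q \<subseteq> P\<close> by (rule inj_on_subset)
  qed
  have "countable \<D>"
  proof (rule countable_image_inj_on)
    show "countable (set_code ` \<D>)" by (rule countable_subset[OF _ count]) (auto simp: \<D>_def elts_def)
    show "inj_on set_code \<D>"
      by (rule inj_onI, rule set_code_inject) (auto simp: \<D>_def dense_in_poset_def)
  qed
  \<comment> \<open>The whole poset is a dense set whose code is available in \<open>N\<close>; this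
    keeps \<open>\<D>\<close> nonempty.\<close>
  have "set_code P = u" using u_in elts_u by (intro set_code_unique) auto
  moreover have "dense_in_poset P le P" using le_refl by (auto simp: dense_in_poset_def)
  ultimately have "\<D> \<noteq> {}" using u_N by (auto simp: \<D>_def)
  have closed: "\<exists>r \<in> Q. step i p q D r" if Q: "p \<in> Q" "q \<in> Q" "D \<in> \<D>" for i p q D
  proof -
    have P: "p \<in> P" "q \<in> P" "dense_in_poset P le D" using Q by (auto simp: Q_def \<D>_def)
    note D = dense_subset[OF P(3)]
    have t: "(tuple i p q D, N) \<in> E"
      unfolding tuple_def by (intro kpair_N numeral_N) (use Q in \<open>simp_all add: Q_def \<D>_def\<close>)
    have tH: "tuple i p q D \<in> H" by (rule tuple_in[OF P(1,2) D])
    obtain r where r: "r \<in> P" "step i p q D r" using total[OF P] by blast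
    have "(kpair (tuple i p q D) (c r), F) \<in> E"
      unfolding mem_iff_elts F using P(1,2) D r by blast
    moreover have "kpair_in H E (tuple i p q D) (c r) (kpair (tuple i p q D) (c r))"
      using kpair_in_iff[OF tH c_in[OF r(1)]] kpair(2)[OF tH c_in[OF r(1)]] by simp
    ultimately obtain b z where bz: "b \<in> H" "(b, N) \<in> E" "(z, F) \<in> E" "kpair_in H E (tuple i p q D) b z"
      using F_N tH t c_in[OF r(1)] kpair(1)[OF tH c_in[OF r(1)]] by meson
    have z: "z = kpair (tuple i p q D) b"
      using bz(4) kpair_in_iff[OF tH bz(1)] is_kpair_iff[OF tH bz(1)] by simp
    obtain i' p' q' D' r' where F': "z = kpair (tuple i' p' q' D') (c r')" "p' \<in> P" "q' \<in> P" "D' \<subseteq> P"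
        "r' \<in> P" "step i' p' q' D' r'"
      using bz(3) unfolding mem_iff_elts F by blast
    have tH': "tuple i' p' q' D' \<in> H" by (rule tuple_in[OF F'(2-4)])
    \<comment> \<open>The value found in \<open>N\<close> need not be the code of \<open>r\<close>;
      injectivity of the coding shows that it is another result of the same step.\<close>
    have "kpair (tuple i p q D) b = kpair (tuple i' p' q' D') (c r')" using z F'(1) by metis
    then have eq: "tuple i p q D = tuple i' p' q' D'" "b = c r'"
      unfolding kpair_inject[OF tH bz(1) tH' c_in[OF F'(5)]] by (rule conjunct1, rule conjunct2)
    have "i = i' \<and> p = p' \<and> q = q' \<and> D = D'"
      using tuple_inject[OF P(1,2) D F'(2-4) eq(1)] .
    moreover have "r' \<in> Q" using F'(5) bz(2) eq(2) by (simp add: Q_def)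
    ultimately show ?thesis using F'(6) by blast
  qed
  show "generic_in H E u l N"
    unfolding generic_in_def
  proof (intro ballI impI)
    fix x assume x: "x \<in> H" "(x, N) \<in> E \<and> (x, u) \<in> E"
    then obtain p where p: "p \<in> P" "x = c p" using mem_u by blast
    then have "p \<in> Q" using x by (simp add: Q_def)
    have "\<exists>q \<in> P. le q p \<and> (\<forall>D \<in> \<D>. predense_below P le q (D \<inter> Q))"
      by (rule generic[OF \<open>countable Q\<close> \<open>Q \<subseteq> P\<close> \<open>countable \<D>\<close> \<open>\<D> \<noteq> {}\<close> _ closed \<open>p \<in> Q\<close>])
        (simp add: \<D>_def)
    then obtain q where q: "q \<in> P" "le q p" "\<And>D. D \<in> \<D> \<Longrightarrow> predense_below P le q (D \<inter> Q)"
      by blast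
    show "\<exists>q \<in> H. (q, u) \<in> E \<and> le_in H E l q x \<and>
       (\<forall>D \<in> H. (D, N) \<in> E \<and> (\<forall>a \<in> H. (a, D) \<in> E \<longrightarrow> (a, u) \<in> E) \<and>
            (\<forall>a \<in> H. (a, u) \<in> E \<longrightarrow> (\<exists>b \<in> H. (b, D) \<in> E \<and> le_in H E l b a)) \<longrightarrow>
          (\<forall>r \<in> H. (r, u) \<in> E \<and> le_in H E l r q \<longrightarrow>
             (\<exists>d \<in> H. \<exists>t \<in> H. (d, D) \<in> E \<and> (d, N) \<in> E \<and> (t, u) \<in> E \<and>
                le_in H E l t d \<and> le_in H E l t r)))"
    proof (rule bexI[OF _ c_in[OF q(1)]], intro conjI ballI impI)
      show "(c q, u) \<in> E" using q(1) mem_u by blast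
      show "le_in H E l (c q) x" using le_in_iff q(1,2) p by simp
    next
      fix D' y assume D': "D' \<in> H" "(D', N) \<in> E \<and> (\<forall>a \<in> H. (a, D') \<in> E \<longrightarrow> (a, u) \<in> E) \<and>
          (\<forall>a \<in> H. (a, u) \<in> E \<longrightarrow> (\<exists>b \<in> H. (b, D') \<in> E \<and> le_in H E l b a))"
        and y: "y \<in> H" "(y, u) \<in> E \<and> le_in H E l y (c q)"
      define D where "D = {d \<in> P. (c d, D') \<in> E}"
      have sub: "D \<subseteq> P" by (auto simp: D_def)
      have "elts E D' \<subseteq> c ` P"
        using D'(2) E_subset(1) mem_u unfolding elts_def by blast
      then have elts_D: "elts E D' = c ` D" by (auto simp: D_def elts_def)
      then have code: "set_code D = D'" using set_code_unique[OF sub D'(1)] by simp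
      have "\<exists>d \<in> D. le d a" if a: "a \<in> P" for a
      proof -
        have "(c a, u) \<in> E" using a mem_u by blast
        then obtain b where "(b, D') \<in> E" "le_in H E l b (c a)"
          using D'(2) c_in[OF a] by blast
        moreover from this obtain d where "d \<in> D" "b = c d" using elts_D unfolding elts_def by blast
        ultimately show ?thesis using le_in_iff[of d a] sub a by blast
      qed
      then have "dense_in_poset P le D" using sub by (simp add: dense_in_poset_def)
      then have "D \<in> \<D>" using D'(2) code by (simp add: \<D>_def)
      then have pre: "predense_below P le q (D \<inter> Q)" by (rule q(3))
      obtain r where r: "r \<in> P" "y = c r" using y(2) mem_u by blast
      then have "le r q" using y(2) le_in_iff q(1) by simp
      then obtain d t where dt: "d \<in> D \<inter> Q" "t \<in> P" "le t d" "le t r"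
        using pre r(1) unfolding predense_below_def compatible_def by blast
      then have "d \<in> P" by (simp add: D_def)
      show "\<exists>d \<in> H. \<exists>t \<in> H. (d, D') \<in> E \<and> (d, N) \<in> E \<and> (t, u) \<in> E \<and> le_in H E l t d \<and> le_in H E l t y"
      proof (rule bexI[OF bexI[OF _ c_in[OF dt(2)]] c_in[OF \<open>d \<in> P\<close>]], intro conjI)
        show "(c d, D') \<in> E" "(c d, N) \<in> E" using dt(1) by (simp_all add: D_def Q_def)
        show "(c t, u) \<in> E" using dt(2) mem_u by blast
        show "le_in H E l (c t) (c d)" "le_in H E l (c t) y"
          using le_in_iff dt r \<open>d \<in> P\<close> by simp_all
      qed
    qed
  qed
qed

text \<open>A guide \<open>F'\<close> is found inside \<open>M\<close>. Being countable,
  \<open>M\<close> is the extension of a member \<open>N\<close> of \<open>H\<close>, and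
  elementarity makes \<open>N\<close> closed under pairs and \<open>F'\<close>, so the guide applies
  to \<open>N\<close>.\<close>

lemma generic_condition_submodel:
  fixes step :: "'i::countable \<Rightarrow> 'p \<Rightarrow> 'p \<Rightarrow> 'p set \<Rightarrow> 'p \<Rightarrow> bool"
  assumes M: "countable M" "elementary_submodel M H E" "u \<in> M" "l \<in> M"
    and F: "F \<in> H" "guides_in H E u l F" and p: "p \<in> P" "c p \<in> M"
  shows "\<exists>q \<in> P. le q p \<and> generic_condition M E P le c q"
proof -
  have "M \<subseteq> H" using M(2) unfolding elementary_submodel_def by (rule conjunct1)
  obtain F' where F': "F' \<in> M" "guides_in H E u l F'"
  proof -
    let ?s = "\<lambda>i::nat. if i = 1 then l else u"
    have "range ?s \<subseteq> M" using M by auto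
    moreover have "sat H E (All 3 (Imp (Conj Closed Orbit) Generic)) (?s(2 := F))"
      unfolding sat_guides using F(2) by simp
    ultimately obtain b where "b \<in> M" "sat H E (All 3 (Imp (Conj Closed Orbit) Generic)) (?s(2 := b))"
      using elementary_submodel_witness[OF M(2) _ F(1)] by blast
    then show thesis using that unfolding sat_guides by simp
  qed
  obtain N where N: "N \<in> H" "elts E N = M" using ex_elts_countable[OF \<open>M \<subseteq> H\<close> M(1)] by blast
  have mem_N: "(x, N) \<in> E \<longleftrightarrow> x \<in> M" for x using N(2) by (auto simp: elts_def)
  have kpair_M: "kpair a b \<in> M" if ab: "a \<in> M" "b \<in> M" for a b
  proof -
    have H: "a \<in> H" "b \<in> H" using ab \<open>M \<subseteq> H\<close> by auto
    let ?s = "\<lambda>i::nat. if i = 0 then a else b"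
    have "range ?s \<subseteq> M" using ab by auto
    moreover have "sat H E (Kpair 0 1 2) (?s(2 := kpair a b))"
      using kpair_in_iff[OF H] kpair(2)[OF H] by simp
    ultimately obtain z where "z \<in> M" "sat H E (Kpair 0 1 2) (?s(2 := z))"
      using elementary_submodel_witness[OF M(2) _ kpair(1)[OF H]] by blast
    then show ?thesis using kpair_in_iff[OF H] is_kpair_iff[OF H] by simp
  qed
  have "closed_in H E u F' N"
    unfolding closed_in_def mem_N
  proof (intro conjI ballI impI)
    show "u \<in> M" by (rule M)
    show "\<exists>z \<in> H. z \<in> M \<and> kpair_in H E a b z" if "a \<in> H" "b \<in> H" "a \<in> M \<and> b \<in> M" for a b
      using that kpair_M kpair[OF that(1,2)] kpair_in_iff[OF that(1,2)] by blast
    show "\<exists>b \<in> H. \<exists>z \<in> H. b \<in> M \<and> (z, F') \<in> E \<and> kpair_in H E a b z"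
      if a: "a \<in> H" "a \<in> M \<and> (\<exists>b \<in> H. \<exists>z \<in> H. (z, F') \<in> E \<and> kpair_in H E a b z)" for a
    proof -
      let ?s = "\<lambda>i::nat. if i = 0 then a else F'"
      let ?\<phi> = "Exists 3 (Conj (Mem 3 1) (Kpair 0 2 3))"
      have s: "range ?s \<subseteq> M" using a F'(1) by auto
      obtain b where "b \<in> H" "\<exists>z \<in> H. (z, F') \<in> E \<and> kpair_in H E a b z" using a(2) by blast
      then have "sat H E ?\<phi> (?s(2 := b))" by simp
      then obtain b' where "b' \<in> M" "sat H E ?\<phi> (?s(2 := b'))"
        using elementary_submodel_witness[OF M(2) s \<open>b \<in> H\<close>] by blast
      then have "b' \<in> M" "\<exists>z \<in> H. (z, F') \<in> E \<and> kpair_in H E a b' z" by simp_all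
      then show ?thesis using \<open>M \<subseteq> H\<close> by blast
    qed
  qed
  moreover have "orbit_in H E N"
  proof (rule countable_orbit_in)
    show "countable (elts E N)" using N(2) M(1) by simp
    \<comment> \<open>The numerals show that \<open>M\<close> is infinite, as the orbit description
      of countability requires.\<close>
    have "numeral_code u n \<in> M" for n by (induction n) (simp_all add: M kpair_M)
    then have "range (numeral_code u) \<subseteq> M" by blast
    then show "infinite (elts E N)"
      unfolding N(2) using inj_numeral_code[OF u_in] range_inj_infinite infinite_super by blast
  qed
  ultimately have gen: "generic_in H E u l N" using F'(2) N(1) by (simp add: guides_in_def)
  have cp: "(c p, N) \<in> E \<and> (c p, u) \<in> E" using p mem_N mem_u by blast
  obtain x where x: "(x, u) \<in> E" "le_in H E l x (c p)" and
    pre: "\<forall>D \<in> H. (D, N) \<in> E \<and> (\<forall>a \<in> H. (a, D) \<in> E \<longrightarrow> (a, u) \<in> E) \<and>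
            (\<forall>a \<in> H. (a, u) \<in> E \<longrightarrow> (\<exists>b \<in> H. (b, D) \<in> E \<and> le_in H E l b a)) \<longrightarrow>
          (\<forall>r \<in> H. (r, u) \<in> E \<and> le_in H E l r x \<longrightarrow>
             (\<exists>d \<in> H. \<exists>t \<in> H. (d, D) \<in> E \<and> (d, N) \<in> E \<and> (t, u) \<in> E \<and>
                le_in H E l t d \<and> le_in H E l t r))"
    using bspec[OF gen[unfolded generic_in_def] c_in[OF p(1)], THEN mp, OF cp] by (elim bexE conjE)
  obtain q where q: "q \<in> P" "x = c q" using x(1) mem_u by blast
  have "le q p" using x(2) le_in_iff p(1) q by simp
  moreover have "generic_condition M E P le c q"
    unfolding generic_condition_def predense_below_def
  proof (intro allI impI ballI)
    fix D r
    assume D: "dense_in_poset P le D \<and> (\<exists>d \<in> M. elts E d = c ` D)" and r: "r \<in> P" "le r q"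
    then obtain D' where D': "D' \<in> M" "elts E D' = c ` D" by blast
    have sub: "D \<subseteq> P" using D dense_subset by blast
    have mem_D': "(a, D') \<in> E \<longleftrightarrow> a \<in> c ` D" for a using D'(2) by (auto simp: elts_def)
    have dense: "\<exists>b \<in> H. (b, D') \<in> E \<and> le_in H E l b a" if a: "(a, u) \<in> E" for a
    proof -
      obtain a' where a': "a' \<in> P" "a = c a'" using a mem_u by blast
      then obtain d where "d \<in> D" "le d a'" using D unfolding dense_in_poset_def by blast
      then show ?thesis using le_in_iff[of d a'] a' sub c_in mem_D' by blast
    qed
    have "D' \<in> H" using D'(1) \<open>M \<subseteq> H\<close> by blast
    moreover have "(D', N) \<in> E \<and> (\<forall>a \<in> H. (a, D') \<in> E \<longrightarrow> (a, u) \<in> E) \<and>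
        (\<forall>a \<in> H. (a, u) \<in> E \<longrightarrow> (\<exists>b \<in> H. (b, D') \<in> E \<and> le_in H E l b a))"
      using D'(1) mem_N mem_D' mem_u sub dense by blast
    ultimately have all_r: "\<forall>r \<in> H. (r, u) \<in> E \<and> le_in H E l r x \<longrightarrow>
             (\<exists>d \<in> H. \<exists>t \<in> H. (d, D') \<in> E \<and> (d, N) \<in> E \<and> (t, u) \<in> E \<and>
                le_in H E l t d \<and> le_in H E l t r)"
      using pre by blast
    have "(c r, u) \<in> E \<and> le_in H E l (c r) x" using r q le_in_iff mem_u by blast
    from bspec[OF all_r c_in[OF r(1)], THEN mp, OF this]
    obtain a b where ab: "(a, D') \<in> E" "(a, N) \<in> E" "(b, u) \<in> E" "le_in H E l b a" "le_in H E l b (c r)"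
      by (elim bexE conjE)
    obtain d where d: "d \<in> D" "a = c d" using ab(1) mem_D' by blast
    obtain t where t: "t \<in> P" "b = c t" using ab(3) mem_u by blast
    have "le t d" "le t r" using ab(4,5) le_in_iff d t r(1) sub by blast+
    moreover have "d \<in> {p \<in> D. c p \<in> M}" using d ab(2) mem_N by blast
    ultimately show "\<exists>d \<in> {p \<in> D. c p \<in> M}. compatible P le d r"
      using t(1) unfolding compatible_def by blast
  qed
  ultimately show ?thesis using q(1) by blast
qed

end

text \<open>
  It suffices to find generic conditions for all countable families closed under countably many
  partial operations \<open>step i\<close>. A submodel containing nothing but the poset also contains some coding
  \<open>F\<close> of such operations, because their relevant property is first order in \<open>H\<close>.
\<close>

theorem proper_posetI:
  fixes P :: "'p set" and step :: "'i::countable \<Rightarrow> 'p \<Rightarrow> 'p \<Rightarrow> 'p set \<Rightarrow> 'p \<Rightarrow> bool"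
  assumes refl: "\<And>p. p \<in> P \<Longrightarrow> le p p"
    and total: "\<And>i p q D. p \<in> P \<Longrightarrow> q \<in> P \<Longrightarrow> dense_in_poset P le D \<Longrightarrow> \<exists>r \<in> P. step i p q D r"
    and generic: "\<And>Q \<D> p. countable Q \<Longrightarrow> Q \<subseteq> P \<Longrightarrow> countable \<D> \<Longrightarrow> \<D> \<noteq> {} \<Longrightarrow>
      (\<And>D. D \<in> \<D> \<Longrightarrow> dense_in_poset P le D) \<Longrightarrow>
      (\<And>i p q D. p \<in> Q \<Longrightarrow> q \<in> Q \<Longrightarrow> D \<in> \<D> \<Longrightarrow> \<exists>r \<in> Q. step i p q D r) \<Longrightarrow> p \<in> Q \<Longrightarrow>
      \<exists>q \<in> P. le q p \<and> (\<forall>D \<in> \<D>. predense_below P le q (D \<inter> Q))"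
  shows "proper_poset TYPE('u) P le"
  unfolding proper_poset_def
proof (intro allI impI ballI, elim conjE)
  fix \<theta> :: "'u rel" and H E c u l M p
  assume H: "hereditary_structure \<theta> H E" and P: "|Pow P| <o \<theta>" and codes: "codes_poset H E P le c u l"
    and M: "countable M" "elementary_submodel M H E" "u \<in> M" "l \<in> M" and p: "p \<in> P" "c p \<in> M"
  interpret coded_poset \<theta> H E P le c u l
    by (intro coded_poset.intro hereditary.intro coded_poset_axioms.intro H codes P refl)
  obtain F where F: "F \<in> H" "elts E F = {kpair (tuple i p q D) (c r) |i p q D r.
      p \<in> P \<and> q \<in> P \<and> D \<subseteq> P \<and> r \<in> P \<and> step i p q D r}"
    using ex_guide[of step] by blast
  have "guides_in H E u l F" by (rule guides_in[OF F(2) total generic])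
  then show "\<exists>q \<in> P. le q p \<and> generic_condition M E P le c q"
    by (rule generic_condition_submodel[OF M F(1) _ p])
qed

section \<open>Properness of the quotient poset\<close>

theorem theorem2p16:
  fixes \<G> :: "'a::polish_space sequence set set"
  assumes "countable \<G>"
    and "\<forall>G \<in> \<G>. nearly_open G"
  shows "proper_poset TYPE('u) (quotient_poset (hypergraph_ideal \<G>)) (\<subseteq>)"
proof -
  obtain \<Phi> where "suslin_closure_family \<Phi>"
    and ideal: "hypergraph_ideal \<G> = Collect (suslin_closure_family.small \<Phi>)"
    using hypergraph_ideal_eq_small[OF assms] .
  then interpret suslin_closure_family \<Phi> by simp
  define P where "P = {B. B \<in> sets borel \<and> \<not> small B}"
  \<comment> \<open>Index \<open>None\<close> enters the dense set \<open>D\<close>; the other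
    indices fulfil the requirements, making a closed family saturated.\<close>
  define step where "step i p q D r \<longleftrightarrow> r \<subseteq> q \<and> (case i of None \<Rightarrow> r \<in> D | Some x \<Rightarrow> fulfils x p q r)"
    for i p q D r
  have "proper_poset TYPE('u) P (\<subseteq>)"
  proof (rule proper_posetI[where step = step])
    fix i p q D assume pq: "p \<in> P" "q \<in> P" and D: "dense_in_poset P (\<subseteq>) D"
    show "\<exists>r \<in> P. step i p q D r"
    proof (cases i)
      case None
      obtain d where "d \<in> D" "d \<subseteq> q" using D pq(2) unfolding dense_in_poset_def by blast
      moreover from this have "d \<in> P" using D unfolding dense_in_poset_def by blast
      ultimately show ?thesis unfolding step_def None by auto
    next
      case (Some x)
      then show ?thesis
        using rich_fulfils[OF rich_borel, of p q x] pq unfolding P_def step_def by simp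
    qed
  next
    fix Q \<D> p
    assume Q: "countable Q" "Q \<subseteq> P" and \<D>: "countable \<D>" "\<D> \<noteq> {}"
      and dense: "\<And>D. D \<in> \<D> \<Longrightarrow> dense_in_poset P (\<subseteq>) D"
      and step: "\<And>i p q D. p \<in> Q \<Longrightarrow> q \<in> Q \<Longrightarrow> D \<in> \<D> \<Longrightarrow> \<exists>r \<in> Q. step i p q D r"
      and p: "p \<in> Q"
    define C where "C = {x \<in> p. \<forall>D \<in> \<D>. \<exists>d \<in> D \<inter> Q. x \<in> d}"
    have "\<not> small C"
      unfolding C_def
    proof (rule generic_points_not_small[OF Q(1) _ _ \<D>(1) _ p])
      show "saturated Q"
        unfolding saturated_def
      proof (intro allI ballI)
        fix x p q assume "p \<in> Q" "q \<in> Q"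
        moreover obtain D where "D \<in> \<D>" using \<D>(2) by blast
        ultimately have "\<exists>r \<in> Q. step (Some x) p q D r" by (rule step)
        then show "\<exists>r \<in> Q. r \<subseteq> q \<and> fulfils x p q r" by (simp add: step_def)
      qed
      show "suslin q \<and> \<not> small q" if "q \<in> Q" for q
        using that Q(2) by (auto simp: P_def intro: suslin_borel)
      show "\<exists>d \<in> D \<inter> Q. d \<subseteq> q" if "D \<in> \<D>" "q \<in> Q" for D q
        using step[OF that(2,2,1), of None] by (auto simp: step_def)
    qed
    moreover have "C \<in> sets borel"
    proof -
      have borel: "q \<in> sets borel" if "q \<in> Q" for q using that Q(2) by (auto simp: P_def)
      have "(\<Inter>D\<in>\<D>. \<Union>d\<in>D \<inter> Q. d) \<in> sets borel"
        using \<D> Q(1) borel by (intro sets.countable_INT' sets.countable_UN' image_subsetI) auto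
      moreover have "C = p \<inter> (\<Inter>D\<in>\<D>. \<Union>d\<in>D \<inter> Q. d)" by (auto simp: C_def)
      ultimately show ?thesis using borel[OF p] by auto
    qed
    ultimately have "C \<in> P" by (simp add: P_def)
    have "predense_below P (\<subseteq>) C (D \<inter> Q)" if D: "D \<in> \<D>" for D
      unfolding predense_below_def
    proof (intro ballI impI)
      fix r assume r: "r \<in> P" "r \<subseteq> C"
      \<comment> \<open>Every point of \<open>r\<close> is generic, so the countably many sets in
        \<open>D \<inter> Q\<close> cover \<open>r\<close>. One of them has a positive trace on
        \<open>r\<close>, and this trace witnesses compatibility.\<close>
      have "\<exists>d \<in> D \<inter> Q. \<not> small (r \<inter> d)"
      proof (rule ccontr)
        assume "\<not> ?thesis"
        then have "small (\<Union>d\<in>D \<inter> Q. r \<inter> d)" using Q(1) by (intro small_UN) auto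
        moreover have "r \<subseteq> (\<Union>d\<in>D \<inter> Q. r \<inter> d)" using r(2) D by (auto simp: C_def)
        ultimately have "small r" by (rule small_subset)
        then show False using r(1) by (simp add: P_def)
      qed
      then obtain d where d: "d \<in> D \<inter> Q" "\<not> small (r \<inter> d)" by blast
      moreover from this have "r \<inter> d \<in> P" using r(1) Q(2) by (auto simp: P_def)
      ultimately show "\<exists>d \<in> D \<inter> Q. compatible P (\<subseteq>) d r"
        unfolding compatible_def by (meson inf_le1 inf_le2)
    qed
    moreover have "C \<subseteq> p" by (auto simp: C_def)
    ultimately show "\<exists>q \<in> P. q \<subseteq> p \<and> (\<forall>D \<in> \<D>. predense_below P (\<subseteq>) q (D \<inter> Q))"
      using \<open>C \<in> P\<close> by blast
  qed simp
  moreover have "quotient_poset (hypergraph_ideal \<G>) = P"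
    by (simp add: quotient_poset_def ideal P_def)
  ultimately show ?thesis by simp
qed

end
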